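(* Let $d,m\ge1$ be integers, let $\mathbf N=(N_1,\dots,N_d)$ be a tuple of positive integers, and let $p_{\mathbf x},p_{\mathbf y}$ be the laws of two zero-mean Gaussian stationary periodic random fields $\mathbf x=\{\mathbf x_{\mathbf t},\ \mathbf t\in\mathbb Z^d\}$ and $\mathbf y=\{\mathbf y_{\mathbf t},\ \mathbf t\in\mathbb Z^d\}$ with values in $\mathbb R^m$ and period $\mathbf N$, whose power spectral densities satisfy $\Phi_{\mathbf x}(\boldsymbol\zeta_{\boldsymbol\ell})>0$ and $\Phi_{\mathbf y}(\boldsymbol\zeta_{\boldsymbol\ell})>0$ (positive definite) for every $\boldsymbol\ell\in\mathbb Z^d_{\mathbf N}$. Let $$d(p_{\mathbf x},p_{\mathbf y})^2:=\inf_{p_{\mathbf x,\mathbf y}}\ \mathbb E\big[\|\mathbf x_{\mathbf t}-\mathbf y_{\mathbf t}\|^2\big],$$ where the infimum is over all jointly Gaussian, jointly stationary, zero-mean laws $p_{\mathbf x,\mathbf y}$ of the pair of $\mathbf N$-periodic fields $(\mathbf x,\mathbf y)$ whose marginals are $p_{\mathbf x}$ and $p_{\mathbf y}$. Then $$d(p_{\mathbf x},p_{\mathbf y})^2=\frac{1}{|\mathbf N|}\operatorname{tr}\sum_{\boldsymbol\ell\in\mathbb Z^d_{\mathbf N}}\Big(\Phi_{\mathbf x}(\boldsymbol\zeta_{\boldsymbol\ell})+\Phi_{\mathbf y}(\boldsymbol\zeta_{\boldsymbol\ell})-2\big(\Phi_{\mathbf y}(\boldsymbol\zeta_{\boldsymbol\ell})^{1/2}\,\Phi_{\mathbf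 x}(\boldsymbol\zeta_{\boldsymbol\ell})\,\Phi_{\mathbf y}(\boldsymbol\zeta_{\boldsymbol\ell})^{1/2}\big)^{1/2}\Big),$$ that is, $d(p_{\mathbf x},p_{\mathbf y})$ is the Hellinger distance between $\Phi_{\mathbf x}$ and $\Phi_{\mathbf y}$.
   Context: Notation: $\mathbb Z^d_{\mathbf N}=\{\mathbf t=(t_1,\dots,t_d)\in\mathbb Z^d:\ 0\le t_l\le N_l-1,\ l=1,\dots,d\}$; $|\mathbf N|=\prod_{l=1}^dN_l$; $j$ is the imaginary unit; $\|\cdot\|$ is the Euclidean norm; $A^{1/2}$ is the Hermitian positive semidefinite square root of a positive semidefinite Hermitian matrix $A$. A random field $\mathbf z=\{\mathbf z_{\mathbf t}\}_{\mathbf t\in\mathbb Z^d}$ is periodic with period $\mathbf N$ if $\mathbf z_{(t_1,\dots,t_l+N_l,\dots,t_d)}=\mathbf z_{(t_1,\dots,t_d)}$ almost surely for every $\mathbf t\in\mathbb Z^d$ and every $l=1,\dots,d$. A zero-mean stationary $\mathbf N$-periodic field with values in $\mathbb R^n$ has covariance field $R_{\mathbf t}=\mathbb E[\mathbf z_{\mathbf t+\mathbf s}\mathbf z_{\mathbf s}^T]$ (independent of $\mathbf s$, and $\mathbf N$-periodic in $\mathbf t$). For $\boldsymbol\ell=(\ell_1,\dots,\ell_d)\in\mathbb Z^d_{\mathbf N}$ set $\boldsymbol\zeta_{\boldsymbol\ell}=(\zeta_{\ell_1},\dots,\zeta_{\ell_d})$ with $\zeta_{\ell_i}=e^{j\frac{2\pi}{N_i}\ell_i}$,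 and $\boldsymbol\zeta_{\boldsymbol\ell}^{-\mathbf t}=\prod_{i=1}^d\zeta_{\ell_i}^{-t_i}$. The power spectral density is the Hermitian positive semidefinite matrix function $\Phi(\boldsymbol\zeta_{\boldsymbol\ell})=\sum_{\mathbf t\in\mathbb Z^d_{\mathbf N}}R_{\mathbf t}\boldsymbol\zeta_{\boldsymbol\ell}^{-\mathbf t}$, $\boldsymbol\ell\in\mathbb Z^d_{\mathbf N}$. Since the fields are zero-mean Gaussian, a law is determined by its covariance field. The joint law $p_{\mathbf x,\mathbf y}$ is the law of the $\mathbb R^{2m}$-valued zero-mean stationary $\mathbf N$-periodic Gaussian field $[\mathbf x_{\mathbf t}^T\ \mathbf y_{\mathbf t}^T]^T$, and the marginal constraints say that the law of its $\mathbf x$-component is $p_{\mathbf x}$ and that of its $\mathbf y$-component is $p_{\mathbf y}$. By stationarity the cost does not depend on $\mathbf t$. *)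

theory Defs
  imports "HOL-Probability.Probability"
begin

section \<open>Laws of random fields on the integer lattice\<close>

text \<open>
  A random field indexed by \<open>int ^ 'd\<close> is represented by its law, a probability measure on the
  path space with the product (cylinder) sigma-algebra. The value space \<open>'a\<close> is \<open>real ^ 'm\<close> for
  a single field and \<open>(real ^ 'm) \<times> (real ^ 'm)\<close> for a pair of fields.
\<close>

definition path_space :: "(int ^ 'd \<Rightarrow> 'a::euclidean_space) measure" where
  "path_space = PiM UNIV (\<lambda>_. borel)"

text \<open>Degenerate Gaussians (point masses) are included: for a periodic field, combinations such
  as the difference of two values one period apart have variance zero.\<close>

definition gaussian_measure :: "real measure \<Rightarrow> bool" where
  "gaussian_measure \<mu> \<longleftrightarrow>
     (\<exists>a. \<mu> = return borel a) \<or>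
     (\<exists>a \<sigma>. 0 < \<sigma> \<and> \<mu> = density lborel (\<lambda>x. ennreal (normal_density a \<sigma> x)))"

definition gaussian_field :: "(int ^ 'd \<Rightarrow> 'a::euclidean_space) measure \<Rightarrow> bool" where
  "gaussian_field p \<longleftrightarrow>
     (\<forall>T (a :: int ^ 'd \<Rightarrow> 'a). finite T \<longrightarrow>
        gaussian_measure (distr p borel (\<lambda>z. \<Sum>t\<in>T. a t \<bullet> z t)))"

definition zero_mean_field :: "(int ^ 'd \<Rightarrow> 'a::euclidean_space) measure \<Rightarrow> bool" where
  "zero_mean_field p \<longleftrightarrow> (\<forall>t. integrable p (\<lambda>z. z t) \<and> (LINT z|p. z t) = 0)"

definition stationary_field :: "(int ^ 'd \<Rightarrow> 'a::euclidean_space) measure \<Rightarrow> bool" where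
  "stationary_field p \<longleftrightarrow> (\<forall>s. distr p path_space (\<lambda>z t. z (t + s)) = p)"

definition periodic_field :: "nat ^ 'd \<Rightarrow> (int ^ 'd \<Rightarrow> 'a::euclidean_space) measure \<Rightarrow> bool" where
  "periodic_field N p \<longleftrightarrow> (\<forall>t l. AE z in p. z (t + axis l (int (N $ l))) = z t)"

definition gsp_law :: "nat ^ 'd \<Rightarrow> (int ^ 'd \<Rightarrow> 'a::euclidean_space) measure \<Rightarrow> bool" where
  "gsp_law N p \<longleftrightarrow>
     prob_space p \<and> sets p = sets path_space \<and>
     zero_mean_field p \<and> gaussian_field p \<and> stationary_field p \<and> periodic_field N p"


section \<open>Power spectral density\<close>

definition torus_grid :: "nat ^ 'd \<Rightarrow> (int ^ 'd) set" where
  "torus_grid N = {t. \<forall>i. 0 \<le> t $ i \<and> t $ i \<le> int (N $ i) - 1}"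

definition grid_size :: "nat ^ 'd \<Rightarrow> nat" where
  "grid_size N = (\<Prod>i\<in>UNIV. N $ i)"

definition zeta :: "nat ^ 'd \<Rightarrow> int ^ 'd \<Rightarrow> complex ^ 'd" where
  "zeta N l = (\<chi> i. exp (\<i> * of_real (2 * pi / real (N $ i) * real_of_int (l $ i))))"

definition multi_powi :: "complex ^ 'd \<Rightarrow> int ^ 'd \<Rightarrow> complex" where
  "multi_powi \<zeta> t = (\<Prod>i\<in>UNIV. (\<zeta> $ i) powi (t $ i))"

text \<open>The covariance of \<open>z (t + s)\<close> and \<open>z s\<close>; for a stationary law it does not depend on \<open>s\<close>,
  and \<open>s = 0\<close> is taken.\<close>

definition covariance :: "(int ^ 'd \<Rightarrow> real ^ 'm) measure \<Rightarrow> int ^ 'd \<Rightarrow> real ^ 'm ^ 'm" where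
  "covariance p t = (\<chi> i k. LINT z|p. z t $ i * z 0 $ k)"

definition spectral_density ::
    "nat ^ 'd \<Rightarrow> (int ^ 'd \<Rightarrow> real ^ 'm) measure \<Rightarrow> complex ^ 'd \<Rightarrow> complex ^ 'm ^ 'm" where
  "spectral_density N p \<zeta> =
     (\<chi> i k. \<Sum>t\<in>torus_grid N. of_real (covariance p t $ i $ k) * multi_powi \<zeta> (- t))"


section \<open>Hermitian matrices\<close>

definition adjoint_matrix :: "complex ^ 'm ^ 'n \<Rightarrow> complex ^ 'n ^ 'm" where
  "adjoint_matrix A = (\<chi> i k. cnj (A $ k $ i))"

definition hermitian_form :: "complex ^ 'm ^ 'm \<Rightarrow> complex ^ 'm \<Rightarrow> complex" where
  "hermitian_form A v = (\<Sum>i\<in>UNIV. cnj (v $ i) * (A *v v) $ i)"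

text \<open>The form of a self-adjoint matrix is real-valued, hence the use of \<open>Re\<close>.\<close>

definition pos_semidef :: "complex ^ 'm ^ 'm \<Rightarrow> bool" where
  "pos_semidef A \<longleftrightarrow> adjoint_matrix A = A \<and> (\<forall>v. 0 \<le> Re (hermitian_form A v))"

definition pos_def :: "complex ^ 'm ^ 'm \<Rightarrow> bool" where
  "pos_def A \<longleftrightarrow> adjoint_matrix A = A \<and> (\<forall>v. v \<noteq> 0 \<longrightarrow> 0 < Re (hermitian_form A v))"

text \<open>Well-defined for positive semidefinite \<open>A\<close>, which has exactly one such root.\<close>

definition psd_sqrt :: "complex ^ 'm ^ 'm \<Rightarrow> complex ^ 'm ^ 'm" where
  "psd_sqrt A = (THE B. pos_semidef B \<and> B ** B = A)"


section \<open>The two distances\<close>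

definition couplings ::
    "nat ^ 'd \<Rightarrow> (int ^ 'd \<Rightarrow> real ^ 'm) measure \<Rightarrow> (int ^ 'd \<Rightarrow> real ^ 'm) measure \<Rightarrow>
     (int ^ 'd \<Rightarrow> (real ^ 'm) \<times> (real ^ 'm)) measure set" where
  "couplings N px py =
     {p. gsp_law N p \<and>
         distr p path_space (\<lambda>z t. fst (z t)) = px \<and>
         distr p path_space (\<lambda>z t. snd (z t)) = py}"

text \<open>The cost is evaluated at a site \<open>t\<close>; by stationarity the choice of \<open>t\<close> is immaterial.\<close>

definition law_dist ::
    "nat ^ 'd \<Rightarrow> int ^ 'd \<Rightarrow> (int ^ 'd \<Rightarrow> real ^ 'm) measure \<Rightarrow> (int ^ 'd \<Rightarrow> real ^ 'm) measure
     \<Rightarrow> real" where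
  "law_dist N t px py =
     sqrt (INF p\<in>couplings N px py. LINT z|p. (norm (fst (z t) - snd (z t)))\<^sup>2)"

definition hellinger_dist ::
    "nat ^ 'd \<Rightarrow> (complex ^ 'd \<Rightarrow> complex ^ 'm ^ 'm) \<Rightarrow> (complex ^ 'd \<Rightarrow> complex ^ 'm ^ 'm)
     \<Rightarrow> real" where
  "hellinger_dist N \<Phi> \<Psi> =
     sqrt (Re (1 / of_nat (grid_size N) *
       trace (\<Sum>l\<in>torus_grid N.
         \<Phi> (zeta N l) + \<Psi> (zeta N l)
         - 2 *\<^sub>R psd_sqrt (psd_sqrt (\<Psi> (zeta N l)) ** \<Phi> (zeta N l) ** psd_sqrt (\<Psi> (zeta N l))))))"

end

theory Submission
  imports Defs
begin

text \<open>
  Write \<open>P\<close>, \<open>Q\<close> for the two spectral densities at a frequency, \<open>R\<close> for the root of \<open>Q\<close> and \<open>S\<close>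
  for the root of \<open>R P R\<close>. The matrix \<open>T = R S\<^sup>-\<^sup>1 R\<close> is positive definite and satisfies
  \<open>T P T = Q\<close> and \<open>tr (T P) = tr (T\<^sup>-\<^sup>1 Q) = tr S\<close>. For the lower bound, integrate
  \<open>2 u \<bullet> v \<le> u \<bullet> T u + v \<bullet> T\<^sup>-\<^sup>1 v\<close> with \<open>u\<close>, \<open>v\<close> the discrete Fourier transforms of the two
  coupled fields at each frequency, and use Parseval. For attainment, the inverse
  Fourier transform of \<open>T\<close> is a real convolution kernel, because \<open>T\<close> at the opposite frequency is
  its complex conjugate; convolving \<open>x\<close> with it gives a Gaussian field with the covariances,
  hence the law, of \<open>y\<close>.
\<close>

section \<open>Positive square roots and the transport matrix\<close>

text \<open>The choice of \<open>T\<close> comes from the equality case of the pointwise inequality: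
  equality holds exactly when \<open>v = T u\<close>. A coupling that attains the bound should
  therefore make \<open>y\<close> a deterministic filter of \<open>x\<close> with frequency response
  \<open>T\<close>; such a filter has density \<open>T P T\<close>, and \<open>T P T = Q\<close>
  singles out the positive definite \<open>T\<close>. Positive definiteness of both densities makes
  \<open>R\<close> and \<open>S\<close> invertible, so that \<open>T\<close> and its inverse exist.

  Two obstacles shape the development. The root is a definite description, so its existence and
  uniqueness come first; a complex matrix is treated as a self-adjoint operator on a real Euclidean
  space, whose inner product is the real part of the Hermitian one, and complex linearity of the
  root is recovered from uniqueness. Moreover the filtered field must have the law of
  \<open>y\<close> as a measure on path space, not merely its covariances. Linear functionals of
  both fields have equal Gaussian laws, and characteristic functions then yield equality on cylinder
  sets, one coordinate at a time.\<close>

lemma selfadjoint_eigenvector: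
  fixes f :: "'a::euclidean_space \<Rightarrow> 'a"
  assumes lin: "linear f" and sa: "\<And>x y. f x \<bullet> y = x \<bullet> f y"
    and W: "subspace W" and inv: "\<And>w. w \<in> W \<Longrightarrow> f w \<in> W" and ne: "x0 \<in> W" "x0 \<noteq> 0"
  obtains v c where "v \<in> W" "norm v = 1" "f v = c *\<^sub>R v"
proof -
  interpret f: linear f by (rule lin)
  let ?K = "W \<inter> sphere 0 1"
  have "compact ?K"
    by (intro closed_Int_compact closed_subspace W) simp
  moreover have "(1 / norm x0) *\<^sub>R x0 \<in> ?K"
    using ne W by (auto simp: subspace_scale)
  moreover have "continuous_on ?K (\<lambda>x. x \<bullet> f x)"
    using lin by (intro continuous_on_inner continuous_on_id linear_continuous_on)
      (simp add: linear_conv_bounded_linear)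
  ultimately obtain v where v: "v \<in> ?K" and max: "\<And>w. w \<in> ?K \<Longrightarrow> w \<bullet> f w \<le> v \<bullet> f v"
    by (metis (no_types, lifting) continuous_attains_sup empty_iff)
  define c where "c = v \<bullet> f v"
  have vW: "v \<in> W" and v1: "v \<bullet> v = 1" using v by (auto simp: norm_eq_1)
  \<comment> \<open>\<open>q\<close> is the quadratic form of \<open>c - f\<close>: nonnegative on
    \<open>W\<close> by maximality of \<open>c\<close>, and zero at \<open>v\<close>. A minimum at
    \<open>v\<close> forces the first-order term in the direction \<open>u = c v - f v\<close> to
    vanish, and that term is \<open>2 s (u \<bullet> u)\<close>.\<close>
  define q where "q w = c * (w \<bullet> w) - w \<bullet> f w" for w
  have q_nonneg: "q w \<ge> 0" if "w \<in> W" for w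
  proof (cases "w = 0")
    case False
    have "(1 / norm w) *\<^sub>R w \<in> ?K"
      using False that W by (auto simp: subspace_scale)
    from max[OF this] have "(w \<bullet> f w) / (norm w * norm w) \<le> c"
      using False by (simp add: f.scale c_def)
    then show ?thesis
      using False by (simp add: q_def divide_simps power2_norm_eq_inner[symmetric] power2_eq_square)
  qed (simp add: q_def f.zero)
  define u where "u = c *\<^sub>R v - f v"
  have uW: "u \<in> W" unfolding u_def using vW W inv by (intro subspace_diff subspace_scale) auto
  have q0: "q (v + s *\<^sub>R u) = 2 * s * (u \<bullet> u) + s\<^sup>2 * q u" for s
  proof -
    have "v \<bullet> f u = u \<bullet> f v" using sa[of v u] by (simp add: inner_commute)
    then have "q (v + s *\<^sub>R u) = c * (v \<bullet> v) - v \<bullet> f v + 2 * s * (u \<bullet> (c *\<^sub>R v - f v)) + s\<^sup>2 * q u"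
      unfolding q_def
      by (simp add: f.add f.scale inner_add inner_diff_right inner_commute[of v u] algebra_simps power2_eq_square)
    then show ?thesis by (simp add: v1 c_def[symmetric] u_def[symmetric])
  qed
  have "u \<bullet> u = 0"
  proof (rule ccontr)
    assume "u \<bullet> u \<noteq> 0"
    then have pos: "u \<bullet> u > 0" by (simp add: order_less_le)
    \<comment> \<open>A negative step at which the linear term beats the quadratic one. The
      \<open>+ 1\<close> keeps the denominator positive even when \<open>q u = 0\<close>.\<close>
    define s where "s = - (u \<bullet> u) / (q u + 1)"
    have qu: "q u \<ge> 0" by (rule q_nonneg[OF uW])
    have "q (v + s *\<^sub>R u) \<ge> 0" using vW uW W by (intro q_nonneg subspace_add subspace_scale)
    then have *: "2 * s * (u \<bullet> u) + s\<^sup>2 * q u \<ge> 0" by (simp add: q0)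
    have "2 * s * (u \<bullet> u) + s\<^sup>2 * q u = (u \<bullet> u)\<^sup>2 / (q u + 1)\<^sup>2 * (- q u - 2)"
    proof -
      have s: "s * (q u + 1) = - (u \<bullet> u)" using qu by (simp add: s_def)
      have "(2 * s * (u \<bullet> u) + s\<^sup>2 * q u) * (q u + 1)\<^sup>2
          = 2 * (u \<bullet> u) * (q u + 1) * (s * (q u + 1)) + (s * (q u + 1))\<^sup>2 * q u"
        by (simp add: power2_eq_square algebra_simps)
      also have "\<dots> = (u \<bullet> u)\<^sup>2 * (- q u - 2)"
        unfolding s by (simp add: power2_eq_square algebra_simps)
      finally show ?thesis using qu by (simp add: divide_simps)
    qed
    also have "\<dots> < 0" using qu pos by (intro mult_pos_neg) auto
    finally show False using * by simp
  qed
  then have "f v = c *\<^sub>R v" by (simp add: u_def)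
  with vW v show ?thesis using that by auto
qed

text \<open>Induction on the number of eigenvectors found. Self-adjointness makes the orthogonal
  complement of those already chosen invariant, and it is nonzero while fewer than
  \<open>DIM('a)\<close> are chosen, so it contains another one. Counting them forces the span to be
  everything at the end.\<close>

lemma selfadjoint_eigenbasis:
  fixes f :: "'a::euclidean_space \<Rightarrow> 'a"
  assumes lin: "linear f" and sa: "\<And>x y. f x \<bullet> y = x \<bullet> f y"
  obtains E where "finite E" "pairwise orthogonal E" "span E = UNIV"
    "\<And>e. e \<in> E \<Longrightarrow> norm e = 1 \<and> (\<exists>c. f e = c *\<^sub>R e)"
proof -
  have "\<exists>E. finite E \<and> card E = n \<and> pairwise orthogonal E \<and> (\<forall>e\<in>E. norm e = 1 \<and> (\<exists>c. f e = c *\<^sub>R e))"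
    if "n \<le> DIM('a)" for n
    using that
  proof (induction n)
    case 0
    show ?case by (rule exI[of _ "{}"]) auto
  next
    case (Suc n)
    then obtain E where E: "finite E" "card E = n" "pairwise orthogonal E"
      "\<And>e. e \<in> E \<Longrightarrow> norm e = 1" "\<And>e. e \<in> E \<Longrightarrow> \<exists>c. f e = c *\<^sub>R e" by auto
    have "dim E < DIM('a)" using Suc.prems E by (meson Suc_le_lessD dim_le_card' order.strict_trans1)
    then obtain x0 where x0: "x0 \<noteq> 0" "\<And>y. y \<in> span E \<Longrightarrow> orthogonal x0 y"
      by (rule orthogonal_to_subspace_exists) auto
    define W where "W = {w. \<forall>e\<in>E. w \<bullet> e = 0}"
    have W: "subspace W" by (auto simp: subspace_def W_def inner_add_left)
    have inv: "f w \<in> W" if "w \<in> W" for w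
      unfolding W_def
    proof safe
      fix e assume "e \<in> E"
      moreover then obtain c where "f e = c *\<^sub>R e" using E by blast
      ultimately show "f w \<bullet> e = 0" using that by (simp add: sa W_def)
    qed
    have "x0 \<in> W" using x0 by (auto simp: W_def orthogonal_def span_base)
    from selfadjoint_eigenvector[OF lin sa W inv this x0(1)]
    obtain v c where v: "v \<in> W" "norm v = 1" "f v = c *\<^sub>R v" by blast
    have "v \<notin> E" using v by (auto simp: W_def norm_eq_1)
    moreover have "pairwise orthogonal (insert v E)"
      using E(3) v(1) by (auto simp: pairwise_insert W_def orthogonal_def inner_commute)
    ultimately show ?case using E v by (intro exI[of _ "insert v E"]) auto
  qed
  from this[of "DIM('a)"] obtain E where E: "finite E" "card E = DIM('a)" "pairwise orthogonal E"
      "\<And>e. e \<in> E \<Longrightarrow> norm e = 1 \<and> (\<exists>c. f e = c *\<^sub>R e)" by auto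
  have "0 \<notin> E" using E(4) by force
  then have "independent E" using E(3) by (rule pairwise_orthogonal_independent[rotated])
  then have "span E = UNIV" using E(2) by (metis dim_UNIV dim_eq_card_independent dim_eq_full)
  with E that show ?thesis by blast
qed

text \<open>Each eigenvector is scaled by the square root of its eigenvalue. With the root written
  as an explicit sum over the eigenbasis, linearity, symmetry and positivity can be read off, and
  the square has to be compared with \<open>f\<close> on eigenvectors only.\<close>

lemma selfadjoint_sqrt_exists:
  fixes f :: "'a::euclidean_space \<Rightarrow> 'a"
  assumes lin: "linear f" and sa: "\<And>x y. f x \<bullet> y = x \<bullet> f y" and psd: "\<And>x. 0 \<le> x \<bullet> f x"
  obtains g where "linear g" "\<And>x y. g x \<bullet> y = x \<bullet> g y" "\<And>x. 0 \<le> x \<bullet> g x" "\<And>x. g (g x) = f x"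
proof -
  obtain E where E: "finite E" "pairwise orthogonal E" "span E = UNIV"
    "\<And>e. e \<in> E \<Longrightarrow> norm e = 1 \<and> (\<exists>c. f e = c *\<^sub>R e)"
    using selfadjoint_eigenbasis[OF lin sa] by blast
  then obtain c where c: "\<And>e. e \<in> E \<Longrightarrow> f e = c e *\<^sub>R e" by metis
  have c_nonneg: "c e \<ge> 0" if "e \<in> E" for e
    using psd[of e] c[OF that] E(4)[OF that] by (simp add: norm_eq_1)
  define g where "g x = (\<Sum>e\<in>E. (sqrt (c e) * (e \<bullet> x)) *\<^sub>R e)" for x
  have ling: "linear g"
    by (rule linearI) (simp_all add: g_def inner_add_right algebra_simps sum.distrib scaleR_sum_right)
  interpret g: linear g by (rule ling)
  have ge: "g e = sqrt (c e) *\<^sub>R e" if "e \<in> E" for e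
  proof -
    have "g e = (\<Sum>e'\<in>E. if e' = e then sqrt (c e) *\<^sub>R e else 0)"
      unfolding g_def
    proof (rule sum.cong)
      fix e' assume "e' \<in> E"
      then have "e' \<noteq> e \<Longrightarrow> e' \<bullet> e = 0" using E(2) that by (auto simp: pairwise_def orthogonal_def)
      then show "(sqrt (c e') * (e' \<bullet> e)) *\<^sub>R e' = (if e' = e then sqrt (c e) *\<^sub>R e else 0)"
        using E(4)[OF that] by (auto simp: norm_eq_1)
    qed simp
    then show ?thesis using that E by simp
  qed
  have "(g \<circ> g) x = f x" for x
  proof (rule linear_eq_on_span[of "g \<circ> g" f E])
    show "linear (g \<circ> g)" using ling by (rule linear_compose) (rule ling)
    show "(g \<circ> g) e = f e" if "e \<in> E" for e
      using that c_nonneg[OF that] by (simp add: ge c g.scale)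
  qed (use lin E in auto)
  moreover have "g x \<bullet> y = x \<bullet> g y" for x y
    by (simp add: g_def inner_sum_left inner_sum_right inner_commute algebra_simps)
  moreover have "0 \<le> x \<bullet> g x" for x
    unfolding g_def inner_sum_right
    by (intro sum_nonneg) (use c_nonneg in \<open>simp add: inner_commute[of x] mult.assoc\<close>)
  ultimately show ?thesis using that ling by simp
qed

text \<open>The two roots are compared on eigenvectors of \<open>g\<close>. If
  \<open>g e = c e\<close> with \<open>c > 0\<close>, then \<open>(h + c) (h - c) e = 0\<close>, and
  \<open>h + c\<close> is injective because \<open>h\<close> is positive. If \<open>c = 0\<close>,
  then \<open>h e \<bullet> h e = e \<bullet> h (h e) = 0\<close>.\<close>

lemma selfadjoint_sqrt_unique:
  fixes g h :: "'a::euclidean_space \<Rightarrow> 'a"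
  assumes g: "linear g" "\<And>x y. g x \<bullet> y = x \<bullet> g y" "\<And>x. 0 \<le> x \<bullet> g x"
    and h: "linear h" "\<And>x y. h x \<bullet> y = x \<bullet> h y" "\<And>x. 0 \<le> x \<bullet> h x"
    and eq: "\<And>x. g (g x) = h (h x)"
  shows "g = h"
proof
  fix x
  interpret g: linear g by (rule g(1))
  interpret h: linear h by (rule h(1))
  obtain E where E: "finite E" "pairwise orthogonal E" "span E = UNIV"
    "\<And>e. e \<in> E \<Longrightarrow> norm e = 1 \<and> (\<exists>c. g e = c *\<^sub>R e)"
    using selfadjoint_eigenbasis[OF g(1,2)] by blast
  show "g x = h x"
  proof (rule linear_eq_on_span[OF g(1) h(1)])
    fix e assume e: "e \<in> E"
    then obtain c where c: "g e = c *\<^sub>R e" using E by blast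
    have "e \<bullet> e = 1" using E(4)[OF e] by (simp add: norm_eq_1)
    then have c0: "c \<ge> 0" using g(3)[of e] c by simp
    have hh: "h (h e) = c\<^sup>2 *\<^sub>R e" using eq[of e] c by (simp add: g.scale power2_eq_square)
    show "g e = h e"
    proof (cases "c = 0")
      case True
      then have "h e \<bullet> h e = 0" using hh h(2)[of e "h e"] by simp
      then show ?thesis using True c by simp
    next
      case False
      define w where "w = h e - c *\<^sub>R e"
      have "h w = - c *\<^sub>R w"
        by (simp add: w_def h.diff h.scale hh algebra_simps power2_eq_square)
      then have "c * (w \<bullet> w) \<le> 0" using h(3)[of w] by simp
      then have "w \<bullet> w = 0" using False c0 by (metis inner_ge_zero inner_eq_zero_iff linorder_not_less mult_pos_pos order_le_less)
      then show ?thesis using c by (simp add: w_def)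
    qed
  qed (use E in auto)
qed

section \<open>Complex matrices as operators on a real Euclidean space\<close>

lemma inner_complex_vec: "x \<bullet> y = Re (\<Sum>i\<in>UNIV. cnj (x $ i) * y $ i)" for x y :: "complex ^ 'm"
  by (simp add: inner_vec_def inner_complex_def)

lemma Re_hermitian_form: "Re (hermitian_form A v) = v \<bullet> (A *v v)"
  by (simp add: hermitian_form_def inner_complex_vec)

lemma inner_adjoint_matrix: "(adjoint_matrix A *v x) \<bullet> y = x \<bullet> (A *v y)"
proof -
  have "(\<Sum>i\<in>UNIV. cnj ((adjoint_matrix A *v x) $ i) * y $ i)
      = (\<Sum>i\<in>UNIV. \<Sum>k\<in>UNIV. cnj (x $ k) * A $ k $ i * y $ i)"
    by (simp add: matrix_vector_mult_def adjoint_matrix_def sum_distrib_left sum_distrib_right mult_ac)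
  also have "\<dots> = (\<Sum>k\<in>UNIV. cnj (x $ k) * (A *v y) $ k)"
    by (subst sum.swap) (simp add: matrix_vector_mult_def sum_distrib_left mult_ac)
  finally show ?thesis by (simp add: inner_complex_vec)
qed

lemma adjoint_matrix_eqI:
  assumes "\<And>x y. (A *v x) \<bullet> y = x \<bullet> (A *v y)" shows "adjoint_matrix A = A"
proof -
  have "adjoint_matrix A *v x = A *v x" for x
    by (rule vector_eq_ldot[THEN iffD1]) (metis assms inner_adjoint_matrix inner_commute)
  then show ?thesis by (simp add: matrix_eq)
qed

text \<open>The bridge from Hermitian matrices to the operator lemmas above: symmetry for the real
  inner product already forces a matrix to equal its conjugate transpose.\<close>

lemma pos_semidef_iff:
  "pos_semidef A \<longleftrightarrow> (\<forall>x y. (A *v x) \<bullet> y = x \<bullet> (A *v y)) \<and> (\<forall>x. 0 \<le> x \<bullet> (A *v x))"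
  unfolding pos_semidef_def Re_hermitian_form using adjoint_matrix_eqI inner_adjoint_matrix by metis

text \<open>Separates strictness off as invertibility, which passes to products and inverses by
  algebra. For the converse, a root \<open>g\<close> gives
  \<open>v \<bullet> (A *v v) = g v \<bullet> g v\<close>, so a vanishing form forces
  \<open>A *v v = 0\<close>.\<close>

lemma pos_def_iff:
  "pos_def A \<longleftrightarrow> pos_semidef A \<and> invertible A" (is "?L \<longleftrightarrow> ?R")
proof
  assume L: ?L
  then have "pos_semidef A"
    unfolding pos_def_def pos_semidef_def Re_hermitian_form by (metis inner_zero_left order_less_imp_le order_refl)
  moreover have "x = 0" if "A *v x = 0" for x
    using L that unfolding pos_def_def Re_hermitian_form by (metis inner_zero_right less_irrefl)
  then have "invertible A"
    by (simp add: invertible_left_inverse matrix_left_invertible_ker)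
  ultimately show ?R by simp
next
  assume R: ?R
  have "0 < v \<bullet> (A *v v)" if "v \<noteq> 0" for v
  proof -
    have sa: "\<And>x y. (A *v x) \<bullet> y = x \<bullet> (A *v y)" and psd: "\<And>x. 0 \<le> x \<bullet> (A *v x)"
      using R by (auto simp: pos_semidef_iff)
    obtain g where g: "\<And>x y. g x \<bullet> y = x \<bullet> g y" "\<And>x. g (g x) = A *v x" "linear g"
      using selfadjoint_sqrt_exists[of "(*v) A"] sa psd matrix_vector_mul_linear by metis
    interpret g: linear g by (rule g(3))
    have "v \<bullet> (A *v v) \<noteq> 0"
    proof
      assume "v \<bullet> (A *v v) = 0"
      then have "g v \<bullet> g v = 0" using g(1)[of v "g v"] g(2) by simp
      then have "A *v v = 0" using g(2)[of v] g.zero by simp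
      moreover have "\<forall>x. A *v x = 0 \<longrightarrow> x = 0"
        using R invertible_left_inverse matrix_left_invertible_ker by blast
      ultimately show False using that by simp
    qed
    with psd[of v] show ?thesis by simp
  qed
  then show ?L using R unfolding pos_def_def Re_hermitian_form pos_semidef_def by simp
qed

text \<open>The operator root \<open>g\<close> is a priori only real-linear and comes from a complex
  matrix once it commutes with multiplication by \<open>\<i>\<close>. Conjugating \<open>g\<close>
  by that rotation gives \<open>g'\<close>, again a positive self-adjoint root of the same operator,
  so uniqueness yields \<open>g' = g\<close>.\<close>

lemma psd_sqrt_ex1:
  assumes "pos_semidef A" shows "\<exists>!B. pos_semidef B \<and> B ** B = A"
proof (rule ex_ex1I)
  have sa: "\<And>x y. (A *v x) \<bullet> y = x \<bullet> (A *v y)" and psd: "\<And>x. 0 \<le> x \<bullet> (A *v x)"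
    using assms by (auto simp: pos_semidef_iff)
  obtain g where g: "linear g" "\<And>x y. g x \<bullet> y = x \<bullet> g y" "\<And>x. 0 \<le> x \<bullet> g x" "\<And>x. g (g x) = A *v x"
    using selfadjoint_sqrt_exists[of "(*v) A"] sa psd matrix_vector_mul_linear by metis
  interpret g: linear g by (rule g(1))
  have J: "(\<i> *s x) \<bullet> y = - (x \<bullet> (\<i> *s y))" for x y :: "complex ^ 'a"
    by (simp add: inner_vec_def inner_complex_def sum_negf[symmetric] algebra_simps)
  define g' where "g' x = - (\<i> *s g (\<i> *s x))" for x
  have JJ: "\<i> *s (\<i> *s x) = - x" for x :: "complex ^ 'a"
    by (simp add: vec_eq_iff)
  have smul_neg: "\<i> *s (- x) = - (\<i> *s x)" for x :: "complex ^ 'a"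
    by (simp add: vec_eq_iff)
  have "g' = g"
  proof (rule selfadjoint_sqrt_unique)
    show "linear g'"
    proof (rule linearI)
      have "\<i> *s (r *\<^sub>R x) = r *\<^sub>R (\<i> *s x)" for r and x :: "complex ^ 'a"
        by (simp add: vec_eq_iff)
      then show "g' (r *\<^sub>R x) = r *\<^sub>R g' x" for r x
        by (simp add: g'_def g.scale)
    qed (simp add: g'_def g.add vec.scale_right_distrib)
  next
    show "g' x \<bullet> y = x \<bullet> g' y" for x y
      unfolding g'_def by (simp add: J g(2))
    show "0 \<le> x \<bullet> g' x" for x
      using g(3)[of "\<i> *s x"] by (simp add: g'_def J)
    show "g' (g' x) = g (g x)" for x
      by (simp add: g'_def smul_neg JJ g.neg g(4)) (simp add: vector_scalar_commute JJ)
  qed (use g in auto)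
  then have gi: "g (\<i> *s x) = \<i> *s g x" for x
    by (metis JJ g'_def minus_minus smul_neg)
  have cs: "c *s x = Re c *\<^sub>R x + Im c *\<^sub>R (\<i> *s x)" for c and x :: "complex ^ 'a"
    by (simp add: vec_eq_iff complex_eq_iff)
  have "g (c *s x) = c *s g x" for c x
    unfolding cs[of c] by (simp only: g.add g.scale gi)
  then have "Vector_Spaces.linear (*s) (*s) g"
    by (simp add: Vector_Spaces.linear_iff vec.vector_space_axioms g.add)
  then have mg: "matrix g *v x = g x" for x by (rule matrix_works)
  show "\<exists>B. pos_semidef B \<and> B ** B = A"
    by (rule exI[of _ "matrix g"])
      (simp add: pos_semidef_iff mg g matrix_eq matrix_vector_mul_assoc[symmetric])
next
  fix B C assume B: "pos_semidef B \<and> B ** B = A" and C: "pos_semidef C \<and> C ** C = A"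
  have "(*v) B = (*v) C"
  proof (rule selfadjoint_sqrt_unique)
    show "B *v (B *v x) = C *v (C *v x)" for x
      using B C by (simp add: matrix_vector_mul_assoc)
  qed (use B C in \<open>auto simp: pos_semidef_iff\<close>)
  then show "B = C" by (simp add: matrix_eq)
qed

lemma psd_sqrt:
  assumes "pos_semidef A"
  shows pos_semidef_psd_sqrt: "pos_semidef (psd_sqrt A)"
    and psd_sqrt_square: "psd_sqrt A ** psd_sqrt A = A"
  using theI'[OF psd_sqrt_ex1[OF assms]] by (simp_all add: psd_sqrt_def)

lemma psd_sqrt_unique: "pos_semidef B \<Longrightarrow> B ** B = A \<Longrightarrow> psd_sqrt A = B"
proof -
  assume B: "pos_semidef B" "B ** B = A"
  have "pos_semidef A"
    using B by (auto simp: pos_semidef_iff matrix_vector_mul_assoc[symmetric]) (metis inner_ge_zero)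
  with B show ?thesis using psd_sqrt psd_sqrt_ex1 by metis
qed

lemma matrix_inv_eqI:
  fixes A :: "'a::field ^ 'n ^ 'n"
  assumes "B ** A = mat 1" shows "matrix_inv A = B"
proof -
  have "invertible A" using assms invertible_left_inverse by blast
  then have "A ** matrix_inv A = mat 1"
    unfolding matrix_inv_def invertible_def by (rule someI2_ex) simp
  then have "B ** (A ** matrix_inv A) = B" by simp
  then show ?thesis by (simp add: matrix_mul_assoc assms)
qed

lemma pos_def_matrix_inv:
  assumes "pos_def A"
  shows "pos_def (matrix_inv A)" "A ** matrix_inv A = mat 1" "matrix_inv A ** A = mat 1"
proof -
  have "invertible A" using assms by (simp add: pos_def_iff)
  then have i: "A ** matrix_inv A = mat 1 \<and> matrix_inv A ** A = mat 1"
    unfolding matrix_inv_def invertible_def by (rule someI_ex)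
  then show 1: "A ** matrix_inv A = mat 1" and "matrix_inv A ** A = mat 1" by auto
  then have "invertible (matrix_inv A)" by (auto simp: invertible_def)
  moreover have Ai: "A *v (matrix_inv A *v x) = x" for x
    by (simp add: matrix_vector_mul_assoc 1)
  have A: "(A *v x) \<bullet> y = x \<bullet> (A *v y)" "0 \<le> x \<bullet> (A *v x)" for x y
    using assms by (auto simp: pos_def_iff pos_semidef_iff)
  have "(matrix_inv A *v x) \<bullet> y = x \<bullet> (matrix_inv A *v y)" for x y
    using A(1)[of "matrix_inv A *v x" "matrix_inv A *v y"] by (simp add: Ai)
  moreover have "0 \<le> x \<bullet> (matrix_inv A *v x)" for x
    using A(2)[of "matrix_inv A *v x"] by (simp add: Ai inner_commute)
  ultimately show "pos_def (matrix_inv A)" by (simp add: pos_def_iff pos_semidef_iff)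
qed

lemma pos_def_congruence:
  assumes "pos_def P" "pos_def R"
  shows "pos_def (R ** P ** R)"
  using assms by (auto simp: pos_def_iff pos_semidef_iff invertible_mult matrix_vector_mul_assoc[symmetric])
    metis+

lemma pos_def_psd_sqrt:
  assumes "pos_def A"
  shows "pos_def (psd_sqrt A)"
proof -
  have "pos_semidef A" "invertible A" using assms by (auto simp: pos_def_iff)
  moreover from this obtain B where "B ** A = mat 1" by (auto simp: invertible_def)
  ultimately have "(B ** psd_sqrt A) ** psd_sqrt A = mat 1"
    by (simp add: matrix_mul_assoc[symmetric] psd_sqrt_square)
  then have "invertible (psd_sqrt A)" using invertible_left_inverse by blast
  then show ?thesis using \<open>pos_semidef A\<close> by (simp add: pos_def_iff psd_sqrt)
qed

text \<open>Conjugates the entries without transposing, unlike \<open>adjoint_matrix\<close>. For a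
  real field this is the effect of negating the frequency on the spectral density.\<close>

definition cnj_matrix :: "complex ^ 'm ^ 'n \<Rightarrow> complex ^ 'm ^ 'n" where
  "cnj_matrix A = (\<chi> i k. cnj (A $ i $ k))"

lemma cnj_matrix_mult: "cnj_matrix (A ** B) = cnj_matrix A ** cnj_matrix B"
  by (simp add: cnj_matrix_def matrix_matrix_mult_def vec_eq_iff)

lemma cnj_matrix_mult_vec: "cnj_matrix A *v x = (\<chi> i. cnj ((A *v (\<chi> i. cnj (x $ i))) $ i))"
  by (simp add: cnj_matrix_def matrix_vector_mult_def vec_eq_iff)

lemma cnj_matrix_mat_1: "cnj_matrix (mat 1) = mat 1"
  by (simp add: cnj_matrix_def mat_def vec_eq_iff)

text \<open>Coordinatewise conjugation of vectors is a self-adjoint involution for the real inner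
  product, and \<open>cnj_matrix A\<close> is \<open>A\<close> conjugated by it.\<close>

lemma pos_semidef_cnj_matrix:
  assumes "pos_semidef A" shows "pos_semidef (cnj_matrix A)"
proof -
  let ?c = "\<lambda>x :: complex ^ 'a. (\<chi> i. cnj (x $ i)) :: complex ^ 'a"
  have "?c x \<bullet> y = x \<bullet> ?c y" for x y
    by (simp add: inner_vec_def inner_complex_def)
  then show ?thesis using assms by (simp add: pos_semidef_iff cnj_matrix_mult_vec) metis
qed

lemma psd_sqrt_cnj_matrix:
  assumes "pos_semidef A" shows "psd_sqrt (cnj_matrix A) = cnj_matrix (psd_sqrt A)"
  using assms
  by (intro psd_sqrt_unique) (simp_all add: pos_semidef_cnj_matrix psd_sqrt cnj_matrix_mult[symmetric])

lemma matrix_inv_cnj_matrix: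
  assumes "pos_def A" shows "matrix_inv (cnj_matrix A) = cnj_matrix (matrix_inv A)"
  by (rule matrix_inv_eqI) (simp add: cnj_matrix_mult[symmetric] pos_def_matrix_inv[OF assms] cnj_matrix_mat_1)

text \<open>The optimal transport map between centred Gaussians with covariances \<open>P\<close> and \<open>Q\<close>.\<close>

definition transport_matrix :: "complex ^ 'm ^ 'm \<Rightarrow> complex ^ 'm ^ 'm \<Rightarrow> complex ^ 'm ^ 'm" where
  "transport_matrix P Q =
     psd_sqrt Q ** matrix_inv (psd_sqrt (psd_sqrt Q ** P ** psd_sqrt Q)) ** psd_sqrt Q"

section \<open>Algebra of the transport matrix\<close>

context
  fixes P R S :: "complex ^ 'm ^ 'm"
  assumes R: "pos_def R" and S: "pos_def S" and SS: "S ** S = R ** P ** R"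
begin

text \<open>Regrouping exposes \<open>R ** P ** R\<close>, that is \<open>S ** S\<close>, between
  two copies of \<open>matrix_inv S\<close>, which cancel it.\<close>

lemma transport_congruence_aux:
  "(R ** matrix_inv S ** R) ** P ** (R ** matrix_inv S ** R) = R ** R"
proof -
  have "(R ** matrix_inv S ** R) ** P ** (R ** matrix_inv S ** R)
      = R ** matrix_inv S ** (R ** P ** R) ** matrix_inv S ** R"
    by (simp add: matrix_mul_assoc)
  also have "\<dots> = R ** (matrix_inv S ** S) ** (S ** matrix_inv S) ** R"
    unfolding SS[symmetric] by (simp only: matrix_mul_assoc)
  finally show ?thesis by (simp add: pos_def_matrix_inv[OF S])
qed

text \<open>Cyclicity of the trace moves the leading \<open>R\<close> to the end, where
  \<open>R ** P ** R = S ** S\<close> meets a single \<open>matrix_inv S\<close>.\<close>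

lemma trace_transport_aux: "trace ((R ** matrix_inv S ** R) ** P) = trace S"
proof -
  have "trace ((R ** matrix_inv S ** R) ** P) = trace (R ** (matrix_inv S ** R ** P))"
    by (simp add: matrix_mul_assoc)
  also have "\<dots> = trace (matrix_inv S ** (R ** P ** R))"
    by (subst trace_mul_sym) (simp add: matrix_mul_assoc)
  also have "\<dots> = trace ((matrix_inv S ** S) ** S)"
    unfolding SS[symmetric] by (simp only: matrix_mul_assoc)
  finally show ?thesis by (simp add: pos_def_matrix_inv[OF S])
qed

text \<open>The inverse of the transport matrix is \<open>matrix_inv R ** S ** matrix_inv R\<close>;
  cyclicity then cancels all factors except \<open>S\<close>.\<close>

lemma trace_inv_transport_aux: "trace (matrix_inv (R ** matrix_inv S ** R) ** (R ** R)) = trace S"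
proof -
  have "(matrix_inv R ** S ** matrix_inv R) ** (R ** matrix_inv S ** R)
     = matrix_inv R ** S ** (matrix_inv R ** R) ** matrix_inv S ** R"
    by (simp only: matrix_mul_assoc)
  also have "\<dots> = matrix_inv R ** (S ** matrix_inv S) ** R"
    by (simp add: pos_def_matrix_inv[OF R] matrix_mul_assoc)
  also have "\<dots> = mat 1"
    by (simp add: pos_def_matrix_inv[OF R] pos_def_matrix_inv[OF S])
  finally have "matrix_inv (R ** matrix_inv S ** R) = matrix_inv R ** S ** matrix_inv R"
    by (rule matrix_inv_eqI)
  then have "trace (matrix_inv (R ** matrix_inv S ** R) ** (R ** R))
      = trace (matrix_inv R ** (S ** (matrix_inv R ** R) ** R))"
    by (simp only: matrix_mul_assoc)
  also have "\<dots> = trace S"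
    by (subst trace_mul_sym) (simp add: pos_def_matrix_inv[OF R] matrix_mul_assoc[symmetric])
  finally show ?thesis .
qed

end

context
  fixes P Q :: "complex ^ 'm ^ 'm"
  assumes P: "pos_def P" and Q: "pos_def Q"
begin

text \<open>The instance \<open>R = psd_sqrt Q\<close> of the preceding algebra; both roots inherit
  positive definiteness from \<open>P\<close> and \<open>Q\<close>.\<close>

lemma transport_roots:
  shows "pos_def (psd_sqrt Q)" "psd_sqrt Q ** psd_sqrt Q = Q"
    and "pos_def (psd_sqrt (psd_sqrt Q ** P ** psd_sqrt Q))"
    and "psd_sqrt (psd_sqrt Q ** P ** psd_sqrt Q) ** psd_sqrt (psd_sqrt Q ** P ** psd_sqrt Q)
       = psd_sqrt Q ** P ** psd_sqrt Q"
proof -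
  have "pos_semidef Q" using Q by (simp add: pos_def_iff)
  then show "psd_sqrt Q ** psd_sqrt Q = Q" by (rule psd_sqrt_square)
  show 1: "pos_def (psd_sqrt Q)" by (rule pos_def_psd_sqrt[OF Q])
  have 2: "pos_def (psd_sqrt Q ** P ** psd_sqrt Q)" by (rule pos_def_congruence[OF P 1])
  then show "pos_def (psd_sqrt (psd_sqrt Q ** P ** psd_sqrt Q))" by (rule pos_def_psd_sqrt)
  show "psd_sqrt (psd_sqrt Q ** P ** psd_sqrt Q) ** psd_sqrt (psd_sqrt Q ** P ** psd_sqrt Q)
       = psd_sqrt Q ** P ** psd_sqrt Q"
    by (rule psd_sqrt_square) (use 2 in \<open>simp add: pos_def_iff\<close>)
qed

lemma pos_def_transport_matrix: "pos_def (transport_matrix P Q)"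
  unfolding transport_matrix_def by (intro pos_def_congruence pos_def_matrix_inv transport_roots)

lemma transport_matrix_congruence: "transport_matrix P Q ** P ** transport_matrix P Q = Q"
  using transport_congruence_aux[OF transport_roots(1,3,4)]
  by (simp only: transport_matrix_def transport_roots(2))

lemma trace_transport_matrix:
  "trace (transport_matrix P Q ** P) = trace (psd_sqrt (psd_sqrt Q ** P ** psd_sqrt Q))"
  using trace_transport_aux[OF transport_roots(1,3,4)] by (simp only: transport_matrix_def)

lemma trace_inv_transport_matrix:
  "trace (matrix_inv (transport_matrix P Q) ** Q) = trace (psd_sqrt (psd_sqrt Q ** P ** psd_sqrt Q))"
  using trace_inv_transport_aux[OF transport_roots(1,3,4)]
  by (simp only: transport_matrix_def transport_roots(2))

text \<open>Products, positive roots and inverses all commute with entrywise conjugation. At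
  opposite frequencies this becomes the symmetry that makes the convolution kernel real.\<close>

lemma transport_matrix_cnj_matrix:
  "transport_matrix (cnj_matrix P) (cnj_matrix Q) = cnj_matrix (transport_matrix P Q)"
proof -
  have 1: "psd_sqrt (cnj_matrix Q) = cnj_matrix (psd_sqrt Q)"
    using Q by (simp add: pos_def_iff psd_sqrt_cnj_matrix)
  have "psd_sqrt (cnj_matrix (psd_sqrt Q ** P ** psd_sqrt Q))
      = cnj_matrix (psd_sqrt (psd_sqrt Q ** P ** psd_sqrt Q))"
    using pos_def_congruence[OF P transport_roots(1)] by (intro psd_sqrt_cnj_matrix) (simp add: pos_def_iff)
  then show ?thesis
    unfolding transport_matrix_def 1
    by (simp add: cnj_matrix_mult matrix_inv_cnj_matrix[OF transport_roots(3), symmetric])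
qed

end

text \<open>Completing the square: with \<open>w = matrix_inv T *v v\<close>, the claim is
  nonnegativity of the form of \<open>T\<close> at \<open>u - w\<close>. Hence equality means
  \<open>v = T *v u\<close>.\<close>

lemma inner_le_quadratic_forms:
  assumes "pos_def T"
  shows "2 * (u \<bullet> v) \<le> u \<bullet> (T *v u) + v \<bullet> (matrix_inv T *v v)"
proof -
  define w where "w = matrix_inv T *v v"
  have "T *v w = v" by (simp add: w_def matrix_vector_mul_assoc pos_def_matrix_inv[OF assms])
  moreover have T: "(T *v x) \<bullet> y = x \<bullet> (T *v y)" "0 \<le> x \<bullet> (T *v x)" for x y
    using assms by (auto simp: pos_def_iff pos_semidef_iff)
  ultimately have "0 \<le> u \<bullet> (T *v u) - 2 * (u \<bullet> v) + w \<bullet> v"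
    using T(2)[of "u - w"] T(1)[of u w]
    by (simp add: matrix_vector_mult_diff_distrib inner_diff inner_commute)
  then show ?thesis by (simp add: w_def inner_commute)
qed

section \<open>Fourier analysis on the discrete torus\<close>

text \<open>A single phase, bilinear and symmetric in frequency and site, so that one orthogonality
  relation serves for sums over either argument.\<close>

definition torus_character :: "nat ^ 'd \<Rightarrow> int ^ 'd \<Rightarrow> int ^ 'd \<Rightarrow> complex" where
  "torus_character N l t = cis (2 * pi * (\<Sum>i\<in>UNIV. of_int (l $ i) * of_int (t $ i) / of_nat (N $ i)))"

lemma multi_powi_zeta: "multi_powi (zeta N l) t = torus_character N l t"
proof -
  have "multi_powi (zeta N l) t = (\<Prod>i\<in>UNIV. cis (2 * pi * (of_int (l $ i) * of_int (t $ i) / of_nat (N $ i))))"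
    unfolding multi_powi_def zeta_def
    by (intro prod.cong refl) (simp add: cis_conv_exp[symmetric] cis_power_int mult_ac del: of_real_mult of_real_divide)
  also have "\<dots> = cis (\<Sum>i\<in>UNIV. 2 * pi * (of_int (l $ i) * of_int (t $ i) / of_nat (N $ i)))"
    by (simp only: cis_conv_exp of_real_sum sum_distrib_left exp_sum finite)
  finally show ?thesis by (simp only: torus_character_def sum_distrib_left)
qed

lemma torus_character_commute: "torus_character N l t = torus_character N t l"
  by (simp add: torus_character_def mult.commute)

lemma torus_character_add: "torus_character N l (s + t) = torus_character N l s * torus_character N l t"
  by (simp add: torus_character_def cis_mult sum.distrib[symmetric] distrib_left[symmetric]
      add_divide_distrib[symmetric])

lemma torus_character_zero [simp]: "torus_character N l 0 = 1"
  by (simp add: torus_character_def)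

lemma torus_character_uminus: "torus_character N l (- t) = cnj (torus_character N l t)"
  by (simp add: torus_character_def cis_cnj sum_negf)

lemma torus_character_diff: "torus_character N l (s - t) = torus_character N l s * cnj (torus_character N l t)"
  using torus_character_add[of N l s "- t"] by (simp add: torus_character_uminus)

lemma torus_character_uminus_left: "torus_character N (- l) t = cnj (torus_character N l t)"
  by (simp add: torus_character_commute[of N _ t] torus_character_uminus)

text \<open>A geometric sum whose ratio \<open>z\<close> is an \<open>n\<close>-th root of unity;
  the ratio equals 1 exactly when \<open>n\<close> divides \<open>l\<close>.\<close>

lemma sum_cis_root_of_unity:
  assumes "0 < n"
  shows "(\<Sum>k\<in>{0..int n - 1}. cis (2 * pi * (of_int l * of_int k / of_nat n))) = (if int n dvd l then of_nat n else 0)"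
proof -
  define z where "z = cis (2 * pi * of_int l / of_nat n)"
  have "{0..int n - 1} = int ` {..<n}"
    by (auto simp: image_def) (metis lessThan_iff nonneg_int_cases of_nat_less_iff)
  then have "(\<Sum>k\<in>{0..int n - 1}. cis (2 * pi * (of_int l * of_int k / of_nat n)))
      = (\<Sum>k<n. cis (2 * pi * (of_int l * of_nat k / of_nat n)))"
    by (simp add: sum.reindex)
  also have "\<dots> = (\<Sum>k<n. z ^ k)"
    by (simp add: z_def Complex.DeMoivre mult_ac)
  also have "\<dots> = (if int n dvd l then of_nat n else 0)"
  proof (cases "int n dvd l")
    case True
    then obtain c where "l = int n * c" by (elim dvdE)
    then have "z = 1" using assms cis_multiple_2pi[of "of_int c"] by (simp add: z_def mult_ac)
    then show ?thesis using True by simp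
  next
    case False
    have "z \<noteq> 1"
    proof
      assume "z = 1"
      then obtain c :: int where "2 * pi * of_int l / of_nat n = of_int (2 * c) * pi"
        by (auto simp: z_def cis_conv_exp exp_eq_1)
      then have "real_of_int l = of_int (c * int n)" using assms by (simp add: field_simps)
      then have "l = c * int n" by (simp only: of_int_eq_iff)
      then show False using False by simp
    qed
    moreover have "z ^ n = 1"
      using assms by (simp add: z_def Complex.DeMoivre cis_multiple_2pi)
    ultimately show ?thesis using False by (simp add: geometric_sum)
  qed
  finally show ?thesis .
qed

text \<open>Identifies the grid with a product of integer intervals. Sums of coordinatewise products
  over the grid then factor, and its cardinality can be computed.\<close>

lemma torus_grid_bij: "bij_betw vec_nth (torus_grid N) (PiE UNIV (\<lambda>i. {0..int (N $ i) - 1}))"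
  by (rule bij_betwI[where g=vec_lambda]) (auto simp: torus_grid_def PiE_iff)

lemma finite_torus_grid [simp]: "finite (torus_grid N)"
  using bij_betw_finite[OF torus_grid_bij[of N]] by (simp add: finite_PiE)

context
  fixes N :: "nat ^ 'd"
  assumes N: "\<forall>i. 0 < N $ i"
begin

lemma grid_size_pos: "0 < grid_size N"
  using N by (simp add: grid_size_def)

text \<open>The character is a product over the coordinates, so the sum factors into one-dimensional
  sums over roots of unity.\<close>

lemma sum_torus_character:
  "(\<Sum>t\<in>torus_grid N. torus_character N l t) = (if \<forall>i. int (N $ i) dvd l $ i then of_nat (grid_size N) else 0)"
proof -
  have "torus_character N l t = (\<Prod>i\<in>UNIV. cis (2 * pi * (of_int (l $ i) * of_int (t $ i) / of_nat (N $ i))))" for t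
    by (simp only: torus_character_def cis_conv_exp of_real_sum sum_distrib_left exp_sum finite)
  then have "(\<Sum>t\<in>torus_grid N. torus_character N l t)
      = (\<Sum>g\<in>PiE UNIV (\<lambda>i. {0..int (N $ i) - 1}). \<Prod>i\<in>UNIV. cis (2 * pi * (of_int (l $ i) * of_int (g i) / of_nat (N $ i))))"
    using sum.reindex_bij_betw[OF torus_grid_bij,
        of "\<lambda>g. \<Prod>i\<in>UNIV. cis (2 * pi * (of_int (l $ i) * of_int (g i) / of_nat (N $ i)))"] by simp
  also have "\<dots> = (\<Prod>i\<in>UNIV. \<Sum>k\<in>{0..int (N $ i) - 1}. cis (2 * pi * (of_int (l $ i) * of_int k / of_nat (N $ i))))"
    by (subst prod_sum_PiE) auto
  also have "\<dots> = (\<Prod>i\<in>UNIV. if int (N $ i) dvd l $ i then of_nat (N $ i) else 0)"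
    by (intro prod.cong refl sum_cis_root_of_unity) (use N in simp)
  also have "\<dots> = (if \<forall>i. int (N $ i) dvd l $ i then of_nat (grid_size N) else 0)"
    by (auto simp: grid_size_def)
  finally show ?thesis .
qed

text \<open>The summand is the character of \<open>l - k\<close>. Coordinates of grid points lie
  within one period, so congruence modulo the period is equality.\<close>

lemma torus_character_orthogonal:
  assumes "l \<in> torus_grid N" "k \<in> torus_grid N"
  shows "(\<Sum>t\<in>torus_grid N. torus_character N l t * cnj (torus_character N k t))
       = (if l = k then of_nat (grid_size N) else 0)"
proof -
  have "torus_character N l t * cnj (torus_character N k t) = torus_character N (l - k) t" for t
    by (simp add: torus_character_commute[of N _ t] torus_character_diff)
  moreover have "(\<forall>i. int (N $ i) dvd (l - k) $ i) \<longleftrightarrow> l = k"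
  proof
    assume dvd: "\<forall>i. int (N $ i) dvd (l - k) $ i"
    have "l $ i = k $ i" for i
    proof -
      have "l $ i mod int (N $ i) = k $ i mod int (N $ i)"
        using dvd by (simp add: mod_eq_dvd_iff)
      moreover have "0 \<le> l $ i" "l $ i < int (N $ i)" "0 \<le> k $ i" "k $ i < int (N $ i)"
        using assms unfolding torus_grid_def by (simp_all add: zle_diff1_eq[symmetric] del: zle_diff1_eq)
      ultimately show ?thesis by simp
    qed
    then show "l = k" by (simp add: vec_eq_iff)
  qed simp
  ultimately show ?thesis by (simp add: sum_torus_character)
qed

definition torus_reduce :: "int ^ 'd \<Rightarrow> int ^ 'd" where
  "torus_reduce t = (\<chi> i. t $ i mod int (N $ i))"

lemma torus_reduce_in_grid: "torus_reduce t \<in> torus_grid N"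
  using N by (auto simp: torus_reduce_def torus_grid_def)

text \<open>\<open>t\<close> differs from its reduction by a sum of multiples of the periods.
  Invariance is extended from one period to all integer multiples in one coordinate, in both
  directions, and then to all coordinates together.\<close>

lemma periodic_torus_reduce:
  fixes f :: "int ^ 'd \<Rightarrow> 'a"
  assumes per: "\<And>t i. f (t + axis i (int (N $ i))) = f t"
  shows "f (torus_reduce t) = f t"
proof -
  have 1: "f (t + axis i (c * int (N $ i))) = f t" for t i c
  proof (induction c rule: int_induct[where k=0])
    case base
    have "axis i 0 = (0 :: int ^ 'd)" by (simp add: axis_def vec_eq_iff)
    then show ?case by (simp only: mult_zero_left add_0_right)
  next
    case (step1 c)
    have "t + axis i ((c + 1) * int (N $ i)) = (t + axis i (c * int (N $ i))) + axis i (int (N $ i))"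
      by (simp add: axis_def vec_eq_iff distrib_right)
    then show ?case using step1 by (simp only: per)
  next
    case (step2 c)
    have "t + axis i (c * int (N $ i)) = (t + axis i ((c - 1) * int (N $ i))) + axis i (int (N $ i))"
      by (simp add: axis_def vec_eq_iff left_diff_distrib)
    then show ?case using step2 by (simp only: per)
  qed
  have 2: "f (t + (\<Sum>i\<in>S. axis i (c i * int (N $ i)))) = f t" if "finite S" for S t c
    using that
  proof (induction S arbitrary: t rule: finite_induct)
    case (insert i S)
    have "t + (\<Sum>i\<in>insert i S. axis i (c i * int (N $ i)))
        = (t + (\<Sum>i\<in>S. axis i (c i * int (N $ i)))) + axis i (c i * int (N $ i))"
      using insert by (simp add: ac_simps)
    then show ?case by (simp only: 1 insert.IH)
  qed simp
  have "torus_reduce t + (\<Sum>i\<in>UNIV. axis i ((t $ i div int (N $ i)) * int (N $ i))) = t"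
    by (simp add: vec_eq_iff axis_def torus_reduce_def if_distrib cong: if_cong)
  then show ?thesis using 2[of UNIV "torus_reduce t" "\<lambda>i. t $ i div int (N $ i)"] by simp
qed

lemma torus_character_reduce: "torus_character N l (torus_reduce t) = torus_character N l t"
proof (rule periodic_torus_reduce)
  fix t i
  have "(\<Sum>k\<in>UNIV. of_int (l $ k) * of_int (axis i (int (N $ i)) $ k) / real (N $ k)) = (\<Sum>k\<in>UNIV. if k = i then of_int (l $ i) else 0 :: real)"
    using N by (intro sum.cong) (auto simp: axis_def)
  then have "torus_character N l (axis i (int (N $ i))) = 1"
    by (simp add: torus_character_def cis_multiple_2pi)
  then show "torus_character N l (t + axis i (int (N $ i))) = torus_character N l t"
    by (simp add: torus_character_add)
qed

lemma torus_fourier_inversion: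
  fixes f :: "int ^ 'd \<Rightarrow> complex"
  assumes per: "\<And>t i. f (t + axis i (int (N $ i))) = f t"
  shows "(\<Sum>l\<in>torus_grid N. (\<Sum>s\<in>torus_grid N. f s * torus_character N l (- s)) * torus_character N l t)
     = of_nat (grid_size N) * f t"
proof -
  \<comment> \<open>Orthogonality speaks of grid points while \<open>t\<close> is arbitrary, so
    \<open>t\<close> is replaced by its representative in the grid; both \<open>f\<close> and the
    characters are periodic.\<close>
  let ?t = "torus_reduce t"
  have "(\<Sum>l\<in>torus_grid N. (\<Sum>s\<in>torus_grid N. f s * torus_character N l (- s)) * torus_character N l t)
     = (\<Sum>l\<in>torus_grid N. \<Sum>s\<in>torus_grid N. f s * (torus_character N ?t l * cnj (torus_character N s l)))"
  proof (rule sum.cong[OF refl])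
    fix l
    have "torus_character N l t = torus_character N ?t l"
      by (simp only: torus_character_commute[of N ?t] torus_character_reduce)
    then show "(\<Sum>s\<in>torus_grid N. f s * torus_character N l (- s)) * torus_character N l t
        = (\<Sum>s\<in>torus_grid N. f s * (torus_character N ?t l * cnj (torus_character N s l)))"
      unfolding sum_distrib_right
      by (intro sum.cong refl) (simp only: torus_character_uminus torus_character_commute[of N _ l] mult_ac)
  qed
  also have "\<dots> = (\<Sum>s\<in>torus_grid N. f s * (\<Sum>l\<in>torus_grid N. torus_character N ?t l * cnj (torus_character N s l)))"
    by (subst sum.swap) (simp add: sum_distrib_left)
  also have "\<dots> = (\<Sum>s\<in>torus_grid N. if ?t = s then f s * of_nat (grid_size N) else 0)"
    by (intro sum.cong) (auto simp: torus_character_orthogonal torus_reduce_in_grid)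
  also have "\<dots> = of_nat (grid_size N) * f ?t"
    by (simp add: torus_reduce_in_grid)
  finally show ?thesis using periodic_torus_reduce[of f t] per by simp
qed

end

section \<open>Laws determined by their one-dimensional projections\<close>

text \<open>After division by its total mass \<open>c\<close>, the weight is a probability density,
  and the hypothesis says that the law of \<open>X\<close> under this density has the same
  characteristic function for \<open>p\<close> and \<open>q\<close>. If \<open>c = 0\<close>, the
  weight vanishes almost everywhere and both sides are zero.\<close>

lemma weighted_char_unique:
  fixes W X :: "'a \<Rightarrow> real"
  assumes p: "prob_space p" and q: "prob_space q" and pq: "sets p = sets q"
    and W[measurable]: "W \<in> borel_measurable p" and X[measurable]: "X \<in> borel_measurable p"
    and bounds: "\<And>z. 0 \<le> W z" "\<And>z. W z \<le> B"
    and eq: "\<And>a. (CLINT z|p. W z *\<^sub>R iexp (a * X z)) = (CLINT z|q. W z *\<^sub>R iexp (a * X z))"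
    and A[measurable]: "A \<in> sets borel"
  shows "(LINT z|p. W z * indicator A (X z)) = (LINT z|q. W z * indicator A (X z))"
proof -
  have Wq[measurable]: "W \<in> borel_measurable q" and Xq[measurable]: "X \<in> borel_measurable q"
    using W X by (simp_all add: measurable_cong_sets[OF pq[symmetric] refl])
  define c where "c = (LINT z|p. W z)"
  \<comment> \<open>At \<open>a = 0\<close> the hypothesis compares the total masses of the two
    weighted measures.\<close>
  have cp: "complex_of_real (LINT z|p. W z) = (CLINT z|p. W z *\<^sub>R iexp (0 * X z))"
    for p by (simp add: scaleR_conv_of_real)
  have cq: "c = (LINT z|q. W z)"
    using eq[of 0] unfolding cp[symmetric] c_def by simp
  have int: "integrable m W" if "prob_space m" "W \<in> borel_measurable m" for m
  proof -
    interpret prob_space m by fact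
    show ?thesis using that(2) bounds by (intro integrable_const_bound[where B=B]) auto
  qed
  show ?thesis
  proof (cases "c = 0")
    case True
    have "(LINT z|m. W z * indicator A (X z)) = 0"
      if "prob_space m" "W \<in> borel_measurable m" "(LINT z|m. W z) = 0" for m
    proof -
      have "AE z in m. W z = 0"
        using integral_nonneg_eq_0_iff_AE[OF int[OF that(1,2)]] bounds that(3) by simp
      then have "AE z in m. W z * indicator A (X z) = 0" by eventually_elim simp
      then show ?thesis by (rule integral_eq_zero_AE)
    qed
    then show ?thesis using p q True c_def cq W Wq by metis
  next
    case False
    have "c \<ge> 0" unfolding c_def using bounds by simp
    with False have c: "c > 0" by simp
    define D where "D m = distr (density m (\<lambda>z. ennreal (W z / c))) borel X" for m
    have D: "real_distribution (D m)"
      "(LINT x|D m. indicator A x) = (LINT z|m. W z * indicator A (X z)) / c"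
      "char (D m) a = (CLINT z|m. W z *\<^sub>R iexp (a * X z)) / c"
      if m: "prob_space m" and [measurable]: "W \<in> borel_measurable m" "X \<in> borel_measurable m"
        and mc: "(LINT z|m. W z) = c" for m a
    proof -
      interpret m: prob_space m by fact
      have "emeasure (density m (\<lambda>z. ennreal (W z / c))) (space m) = (\<integral>\<^sup>+z. ennreal (W z / c) \<partial>m)"
        by (subst emeasure_density) (auto intro!: nn_integral_cong)
      also have "\<dots> = ennreal (LINT z|m. W z / c)"
        using c bounds int[OF m] by (intro nn_integral_eq_integral) auto
      also have "\<dots> = 1" using c mc by simp
      finally interpret d: prob_space "density m (\<lambda>z. ennreal (W z / c))"
        by (intro prob_spaceI) simp
      show "real_distribution (D m)"
        unfolding D_def by (rule d.real_distribution_distr) simp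
      have "(LINT x|D m. indicator A x) = (LINT z|density m (\<lambda>z. ennreal (W z / c)). indicator A (X z) :: real)"
        unfolding D_def by (rule integral_distr) simp_all
      also have "\<dots> = (LINT z|m. (W z / c) *\<^sub>R indicator A (X z))"
        by (rule integral_density) (use c bounds in auto)
      finally have "(LINT x|D m. indicat_real A x) = (LINT z|m. (W z / c) *\<^sub>R indicator A (X z))" .
      then show "(LINT x|D m. indicator A x) = (LINT z|m. W z * indicator A (X z)) / c"
        by simp
      have "char (D m) a = (CLINT z|density m (\<lambda>z. ennreal (W z / c)). iexp (a * X z))"
        unfolding D_def char_def by (rule integral_distr) simp_all
      also have "\<dots> = (CLINT z|m. (W z / c) *\<^sub>R iexp (a * X z))"
        by (rule integral_density) (use c bounds in auto)
      also have "\<dots> = (CLINT z|m. (1 / c) *\<^sub>R (W z *\<^sub>R iexp (a * X z)))"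
        by simp
      also have "\<dots> = (CLINT z|m. W z *\<^sub>R iexp (a * X z)) / c"
        by (subst integral_scaleR_right) (simp add: scaleR_conv_of_real)
      finally show "char (D m) a = (CLINT z|m. W z *\<^sub>R iexp (a * X z)) / c" .
    qed
    note Dp = D[OF p W X c_def[symmetric]] and Dq = D[OF q Wq Xq cq[symmetric]]
    have "char (D p) = char (D q)" by (rule ext) (simp only: Dp(3) Dq(3) eq)
    then have "D p = D q" by (rule Levy_uniqueness[OF Dp(1) Dq(1)])
    then have "(LINT z|p. W z * indicator A (X z)) / c = (LINT z|q. W z * indicator A (X z)) / c"
      using Dp(2) Dq(2) by simp
    then show ?thesis using c by simp
  qed
qed

text \<open>One at a time, the exponential factors are exchanged for indicators by the one-dimensional
  uniqueness theorem; \<open>1 + cos L\<close> and \<open>1 + sin L\<close> serve as nonnegative weights.\<close>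

lemma cylinder_expectation_unique:
  fixes X :: "'i \<Rightarrow> 'a \<Rightarrow> real"
  assumes p: "prob_space p" and q: "prob_space q" and pq: "sets p = sets q"
    and zero: "(\<lambda>_. 0) \<in> F" and neg: "\<And>L. L \<in> F \<Longrightarrow> (\<lambda>z. - L z) \<in> F"
    and add: "\<And>L k b. L \<in> F \<Longrightarrow> k \<in> I \<Longrightarrow> (\<lambda>z. L z + b * X k z) \<in> F"
    and meas: "\<And>L. L \<in> F \<Longrightarrow> L \<in> borel_measurable p"
    and Xm: "\<And>k. k \<in> I \<Longrightarrow> X k \<in> borel_measurable p"
    and eq: "\<And>L. L \<in> F \<Longrightarrow> (CLINT z|p. iexp (L z)) = (CLINT z|q. iexp (L z))"
    and K: "finite K" "K \<subseteq> I" and A: "\<And>k. k \<in> K \<Longrightarrow> A k \<in> sets borel"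
    and L: "L \<in> F"
  shows "(CLINT z|p. (\<Prod>k\<in>K. indicator (A k) (X k z) :: real) *\<^sub>R iexp (L z))
       = (CLINT z|q. (\<Prod>k\<in>K. indicator (A k) (X k z) :: real) *\<^sub>R iexp (L z))"
  using K A L
proof (induction K arbitrary: L rule: finite_induct)
  case empty
  then show ?case using eq by simp
next
  case (insert k K)
  define J :: "'a \<Rightarrow> real" where "J z = (\<Prod>k\<in>K. indicator (A k) (X k z))" for z
  have J2: "\<bar>J z\<bar> \<le> 2" for z
    unfolding J_def by (rule order_trans[of _ 1]) (auto intro!: prod_le_1 simp: abs_prod indicator_def)
  have J01: "0 \<le> J z" "J z \<le> 1" for z
    unfolding J_def by (auto intro!: prod_nonneg prod_le_1 simp: indicator_def)
  have toq: "f \<in> borel_measurable q" if "f \<in> borel_measurable p" for f :: "'a \<Rightarrow> real"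
    using that by (simp add: measurable_cong_sets[OF pq[symmetric] refl])
  have k: "k \<in> I" using insert by auto
  have Ak[measurable]: "A k \<in> sets borel" using insert by auto
  have Xk[measurable]: "X k \<in> borel_measurable p" using k Xm by auto
  have Jm[measurable]: "J \<in> borel_measurable p"
    unfolding J_def using insert.prems Xm
    by (intro borel_measurable_prod borel_measurable_indicator' ) auto
  have IH: "(CLINT z|p. J z *\<^sub>R iexp (M z)) = (CLINT z|q. J z *\<^sub>R iexp (M z))" if "M \<in> F" for M
    unfolding J_def using insert that by auto
  have Lm[measurable]: "L \<in> borel_measurable p" using meas insert by auto
  have integ: "integrable m (\<lambda>z. f z *\<^sub>R iexp (g z))"
    if "prob_space m" "f \<in> borel_measurable m" "g \<in> borel_measurable m" "\<And>z. \<bar>f z\<bar> \<le> 2" for m f and g :: "'a \<Rightarrow> real"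
  proof -
    interpret prob_space m by fact
    show ?thesis using that by (intro integrable_const_bound[where B=2]) auto
  qed
  have integr: "integrable m f"
    if "prob_space m" "f \<in> borel_measurable m" "\<And>z. \<bar>f z\<bar> \<le> 2" for m and f :: "'a \<Rightarrow> real"
  proof -
    interpret prob_space m by fact
    show ?thesis using that by (intro integrable_const_bound[where B=2]) auto
  qed
  let ?f = "\<lambda>z. J z * indicator (A k) (X k z) :: real"
  have f01: "0 \<le> ?f z" "?f z \<le> 1" for z using J01[of z] by (auto simp: indicator_def)
  \<comment> \<open>\<open>c\<close> will be cosine or sine. Its expansion into two exponentials
    reduces the transform of the weight \<open>J z * (1 + c (L z))\<close> along \<open>X k\<close>
    to the induction hypothesis for the functionals \<open>a * X k\<close>,
    \<open>L + a * X k\<close> and \<open>- L + a * X k\<close>.\<close>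
  have trig: "(LINT z|p. ?f z * c (L z)) = (LINT z|q. ?f z * c (L z))"
    if c: "c \<in> borel_measurable borel" "\<And>x. \<bar>c x\<bar> \<le> 1"
      and ca: "\<And>x. complex_of_real (c x) = \<alpha> * iexp x + \<beta> * iexp (- x)" for c :: "real \<Rightarrow> real" and \<alpha> \<beta>
  proof -
    note [measurable] = c(1)
    have c': "- 1 \<le> c x" "c x \<le> 1" for x using c(2)[of x] by auto
    \<comment> \<open>The contribution of the constant 1 in the shifted weight, to be subtracted at
      the end so that only the signed factor \<open>c (L z)\<close> remains.\<close>
    have f1: "(LINT z|p. J z * indicator (A k) (X k z)) = (LINT z|q. J z * indicator (A k) (X k z))"
    proof (rule weighted_char_unique[OF p q pq, where B=1])
      show "(CLINT z|p. J z *\<^sub>R iexp (a * X k z)) = (CLINT z|q. J z *\<^sub>R iexp (a * X k z))" for a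
        using IH[OF add[OF zero k, of a]] by simp
    qed (use J01 in auto)
    have cexp: "(CLINT z|m. (J z * (1 + c (L z))) *\<^sub>R iexp (a * X k z)) =
       (CLINT z|m. J z *\<^sub>R iexp (a * X k z)) + \<alpha> * (CLINT z|m. J z *\<^sub>R iexp (L z + a * X k z))
          + \<beta> * (CLINT z|m. J z *\<^sub>R iexp (- L z + a * X k z))"
      if m: "prob_space m" and [measurable]: "J \<in> borel_measurable m" "X k \<in> borel_measurable m" "L \<in> borel_measurable m" for m a
    proof -
      define G where "G = (\<lambda>g z. J z *\<^sub>R iexp (g z))"
      have i: "integrable m (G (\<lambda>z. a * X k z))" "integrable m (G (\<lambda>z. L z + a * X k z))"
        "integrable m (G (\<lambda>z. - L z + a * X k z))"
        unfolding G_def by (intro integ[OF m] J2; simp)+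
      have 1: "(J z * (1 + c (L z))) *\<^sub>R iexp (a * X k z) = G (\<lambda>z. a * X k z) z
          + \<alpha> * G (\<lambda>z. L z + a * X k z) z + \<beta> * G (\<lambda>z. - L z + a * X k z) z" for z
        by (simp add: G_def scaleR_conv_of_real ca exp_add[symmetric] algebra_simps)
      have 2: "(CLINT z|m. J z *\<^sub>R iexp (g z)) = integral\<^sup>C m (G g)" for g
        by (simp only: G_def)
      show ?thesis
        unfolding 1 2 using i by simp
    qed
    have "(LINT z|p. J z * (1 + c (L z)) * indicator (A k) (X k z)) = (LINT z|q. J z * (1 + c (L z)) * indicator (A k) (X k z))"
    proof (rule weighted_char_unique[OF p q pq, where B=2])
      show "0 \<le> J z * (1 + c (L z))" "J z * (1 + c (L z)) \<le> 2" for z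
        using J01[of z] c'[of "L z"] mult_mono[of "J z" 1 "1 + c (L z)" 2] by auto
      have "(CLINT z|p. J z *\<^sub>R iexp (a * X k z)) = (CLINT z|q. J z *\<^sub>R iexp (a * X k z))" for a
        using IH[OF add[OF zero k, of a]] by simp
      moreover have "(CLINT z|p. J z *\<^sub>R iexp (L z + a * X k z)) = (CLINT z|q. J z *\<^sub>R iexp (L z + a * X k z))" for a
        by (rule IH) (use insert.prems k in \<open>auto intro!: add\<close>)
      moreover have "(CLINT z|p. J z *\<^sub>R iexp (- L z + a * X k z)) = (CLINT z|q. J z *\<^sub>R iexp (- L z + a * X k z))" for a
        by (rule IH[OF add[OF neg[OF insert.prems(3)] k]])
      ultimately show "(CLINT z|p. (J z * (1 + c (L z))) *\<^sub>R iexp (a * X k z)) = (CLINT z|q. (J z * (1 + c (L z))) *\<^sub>R iexp (a * X k z))" for a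
        by (simp only: cexp[OF p Jm Xk Lm] cexp[OF q toq[OF Jm] toq[OF Xk] toq[OF Lm]])
    qed auto
    moreover have "(LINT z|m. J z * (1 + c (L z)) * indicator (A k) (X k z)) = (LINT z|m. ?f z) + (LINT z|m. ?f z * c (L z))"
      if m: "prob_space m" and [measurable]: "J \<in> borel_measurable m" "X k \<in> borel_measurable m" "L \<in> borel_measurable m" for m
    proof -
      have "\<bar>?f z * c (L z)\<bar> \<le> 2" for z
        using f01[of z] c(2)[of "L z"] mult_mono[of "?f z" 1 "\<bar>c (L z)\<bar>" 1]
        by (simp add: abs_mult J01)
      moreover have "\<bar>?f z\<bar> \<le> 2" for z using f01[of z] by auto
      ultimately have "integrable m ?f" "integrable m (\<lambda>z. ?f z * c (L z))"
        by (intro integr m; simp)+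
      then show ?thesis
        by (subst Bochner_Integration.integral_add[symmetric]) (auto simp: algebra_simps)
    qed
    note this[OF p Jm Xk Lm] this[OF q toq[OF Jm] toq[OF Xk] toq[OF Lm]]
    ultimately show ?thesis using f1 by simp
  qed
  have cos: "(LINT z|p. ?f z * cos (L z)) = (LINT z|q. ?f z * cos (L z))"
    by (rule trig[where \<alpha>="1/2" and \<beta>="1/2"])
       (simp_all add: cos_of_real[symmetric] cos_exp_eq mult.commute field_simps)
  have sin: "(LINT z|p. ?f z * sin (L z)) = (LINT z|q. ?f z * sin (L z))"
    by (rule trig[where \<alpha>="1/(2*\<i>)" and \<beta>="-1/(2*\<i>)"])
       (simp_all add: sin_of_real[symmetric] sin_exp_eq mult.commute field_simps)
  have "(CLINT z|m. ?f z *\<^sub>R iexp (L z)) = Complex (LINT z|m. ?f z * cos (L z)) (LINT z|m. ?f z * sin (L z))"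
    if m: "prob_space m" and [measurable]: "J \<in> borel_measurable m" "X k \<in> borel_measurable m" "L \<in> borel_measurable m" for m
  proof -
    have "integrable m (\<lambda>z. ?f z *\<^sub>R iexp (L z))"
      by (intro integ m) (simp_all, metis f01 abs_of_nonneg order_trans one_le_numeral)
    then show ?thesis
      by (simp add: complex_eq_iff Re_exp Im_exp flip: integral_Re integral_Im)
  qed
  note this[OF p Jm Xk Lm] this[OF q toq[OF Jm] toq[OF Xk] toq[OF Lm]]
  then have "(CLINT z|p. ?f z *\<^sub>R iexp (L z)) = (CLINT z|q. ?f z *\<^sub>R iexp (L z))"
    using cos sin by simp
  moreover have "(\<Prod>k\<in>insert k K. indicator (A k) (X k z)) = ?f z" for z
    using insert.hyps by (simp add: J_def mult.commute)
  ultimately show ?case by simp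
qed

section \<open>Finite linear functionals of a field and uniqueness of laws\<close>

definition field_functionals :: "((int ^ 'd \<Rightarrow> 'a::euclidean_space) \<Rightarrow> real) set" where
  "field_functionals = {L. \<exists>T a. finite T \<and> L = (\<lambda>z. \<Sum>t\<in>T. a t \<bullet> z t)}"

lemma field_functional_single: "(\<lambda>z. u \<bullet> z t) \<in> field_functionals"
  unfolding field_functionals_def by (intro CollectI exI[of _ "{t}"] exI[of _ "\<lambda>_. u"]) simp

lemma field_functional_zero: "(\<lambda>_. 0) \<in> field_functionals"
  unfolding field_functionals_def by (intro CollectI exI[of _ "{}"]) simp

lemma field_functional_add:
  assumes "L \<in> field_functionals" "M \<in> field_functionals"
  shows "(\<lambda>z. L z + M z) \<in> field_functionals"
proof -
  obtain S a T b where S: "finite S" "L = (\<lambda>z. \<Sum>t\<in>S. a t \<bullet> z t)"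
    and T: "finite T" "M = (\<lambda>z. \<Sum>t\<in>T. b t \<bullet> z t)"
    using assms unfolding field_functionals_def by blast
  \<comment> \<open>Both coefficient families are extended by zero to the union of the index
    sets.\<close>
  define c where "c t = (if t \<in> S then a t else 0) + (if t \<in> T then b t else 0)" for t
  have "L z + M z = (\<Sum>t\<in>S \<union> T. c t \<bullet> z t)" for z
  proof -
    have "(\<Sum>t\<in>S. a t \<bullet> z t) = (\<Sum>t\<in>S \<union> T. (if t \<in> S then a t else 0) \<bullet> z t)"
      using S T by (intro sum.mono_neutral_cong_left) auto
    moreover have "(\<Sum>t\<in>T. b t \<bullet> z t) = (\<Sum>t\<in>S \<union> T. (if t \<in> T then b t else 0) \<bullet> z t)"
      using S T by (intro sum.mono_neutral_cong_left) auto
    ultimately show ?thesis by (simp add: S T c_def inner_add_left sum.distrib)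
  qed
  then show ?thesis unfolding field_functionals_def using S T by blast
qed

lemma field_functional_sum:
  assumes "\<And>i. i \<in> I \<Longrightarrow> L i \<in> field_functionals"
  shows "(\<lambda>z. \<Sum>i\<in>I. L i z) \<in> field_functionals"
  using assms
  by (induction I rule: infinite_finite_induct)
    (auto intro: field_functional_zero field_functional_add)

lemma field_functional_scale:
  assumes "L \<in> field_functionals" shows "(\<lambda>z. c * L z) \<in> field_functionals"
proof -
  obtain S a where S: "finite S" "L = (\<lambda>z. \<Sum>t\<in>S. a t \<bullet> z t)"
    using assms unfolding field_functionals_def by blast
  then have "(\<lambda>z. c * L z) = (\<lambda>z. \<Sum>t\<in>S. (c *\<^sub>R a t) \<bullet> z t)"
    by (simp add: sum_distrib_left)
  then show ?thesis unfolding field_functionals_def using S by (intro CollectI exI[of _ S] exI[of _ "\<lambda>t. c *\<^sub>R a t"]) auto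
qed

lemma gaussian_field_iff:
  "gaussian_field p \<longleftrightarrow> (\<forall>L\<in>field_functionals. gaussian_measure (distr p borel L))"
  unfolding gaussian_field_def field_functionals_def by blast

lemma measurable_path_component [measurable]:
  "(\<lambda>z. z t) \<in> path_space \<rightarrow>\<^sub>M (borel :: 'a::euclidean_space measure)"
  unfolding path_space_def by simp

lemma measurable_into_path_space:
  assumes "\<And>t. (\<lambda>z. f z t) \<in> M \<rightarrow>\<^sub>M borel"
  shows "f \<in> M \<rightarrow>\<^sub>M path_space"
  unfolding path_space_def by (rule measurable_PiM_single') (use assms in \<open>auto simp: PiE_def\<close>)

lemma space_path_space [simp]: "space path_space = UNIV"
  by (simp add: path_space_def space_PiM PiE_def)

lemma measurable_component_of_law:
  assumes "sets p = sets path_space"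
  shows "(\<lambda>z. z t) \<in> p \<rightarrow>\<^sub>M (borel :: 'a::euclidean_space measure)"
  using measurable_path_component measurable_cong_sets[OF assms refl] by blast

lemma measurable_field_functional:
  assumes "sets p = sets path_space" "L \<in> field_functionals"
  shows "L \<in> borel_measurable p"
proof -
  note [measurable] = measurable_component_of_law[OF assms(1)]
  show ?thesis using assms(2) unfolding field_functionals_def by auto
qed

text \<open>The Cramer-Wold device on path space: equal laws of all linear functionals give equal
  expectations of \<open>iexp (L z)\<close>, hence equal probabilities of cylinder sets, which
  determine the measure.\<close>

theorem path_measure_eqI:
  fixes p q :: "(int ^ 'd \<Rightarrow> 'a::euclidean_space) measure"
  assumes p: "prob_space p" "sets p = sets path_space"
    and q: "prob_space q" "sets q = sets path_space"
    and eq: "\<And>L. L \<in> field_functionals \<Longrightarrow> distr p borel L = distr q borel L"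
  shows "p = q"
proof -
  interpret p: prob_space p by (rule p(1))
  interpret q: prob_space q by (rule q(1))
  define I :: "((int ^ 'd) \<times> 'a) set" where "I = UNIV \<times> Basis"
  define X :: "(int ^ 'd) \<times> 'a \<Rightarrow> (int ^ 'd \<Rightarrow> 'a) \<Rightarrow> real" where "X k z = snd k \<bullet> z (fst k)" for k z
  have XF: "X k \<in> field_functionals" for k
    unfolding X_def by (rule field_functional_single)
  have iexp_eq: "(CLINT z|p. iexp (L z)) = (CLINT z|q. iexp (L z))" if L: "L \<in> field_functionals" for L
  proof -
    have "(CLINT x|distr m borel L. iexp x) = (CLINT z|m. iexp (L z))"
      if "sets m = sets path_space" for m
      by (rule integral_distr) (simp_all add: measurable_field_functional[OF that L])
    from this[OF p(2)] this[OF q(2)] show ?thesis by (simp only: eq[OF L])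
  qed
  have cyl: "emeasure p {z. \<forall>k\<in>K. X k z \<in> A k} = emeasure q {z. \<forall>k\<in>K. X k z \<in> A k}"
    if K: "finite K" and A: "\<And>k. k \<in> K \<Longrightarrow> A k \<in> sets borel" for K A
  proof -
    let ?S = "{z. \<forall>k\<in>K. X k z \<in> A k}"
    have S: "?S \<in> sets path_space"
    proof -
      have "{z \<in> space path_space. \<forall>k\<in>K. X k z \<in> A k} \<in> sets path_space"
      proof (rule sets.sets_Collect_finite_All[OF _ K])
        show "{z \<in> space path_space. X k z \<in> A k} \<in> sets path_space" if "k \<in> K" for k
          using measurable_sets[OF measurable_field_functional[OF refl XF] A[OF that]]
          by (simp add: vimage_def)
      qed
      then show ?thesis by simp
    qed
    have ind: "(\<Prod>k\<in>K. indicator (A k) (X k z) :: real) = indicator ?S z" for z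
      using K by (induction K rule: finite_induct) (auto simp: indicator_def)
    \<comment> \<open>With the zero functional in the exponent, the expectation of the product of
      indicators is the measure of the cylinder.\<close>
    have star: "(CLINT z|m. (\<Prod>k\<in>K. indicator (A k) (X k z) :: real) *\<^sub>R iexp 0) = complex_of_real (measure m ?S)"
      if m: "sets m = sets path_space" for m
    proof -
      have sp: "space m = UNIV" using sets_eq_imp_space_eq[OF m] by simp
      have "(CLINT z|m. (\<Prod>k\<in>K. indicator (A k) (X k z) :: real) *\<^sub>R iexp 0)
          = (CLINT z|m. complex_of_real (indicator ?S z))"
        by (simp only: ind) (simp add: scaleR_conv_of_real)
      also have "\<dots> = complex_of_real (LINT z|m. indicator ?S z)"
        by (rule integral_complex_of_real)
      also have "(LINT z|m. indicator ?S z) = measure m (?S \<inter> space m)"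
        by (rule Bochner_Integration.integral_indicator)
      finally show ?thesis by (simp only: sp Int_UNIV_right)
    qed
    have "(CLINT z|p. (\<Prod>k\<in>K. indicator (A k) (X k z) :: real) *\<^sub>R iexp 0)
       = (CLINT z|q. (\<Prod>k\<in>K. indicator (A k) (X k z) :: real) *\<^sub>R iexp 0)"
    proof (rule cylinder_expectation_unique[where F=field_functionals and I=UNIV and L="\<lambda>_. 0",
          OF p(1) q(1) p(2)[folded q(2)]])
      show "(\<lambda>z. - L z) \<in> field_functionals" if "L \<in> field_functionals" for L :: "(int ^ 'd \<Rightarrow> 'a) \<Rightarrow> real"
        using field_functional_scale[OF that, of "-1"] by simp
      show "(\<lambda>z. L z + b * X k z) \<in> field_functionals" if "L \<in> field_functionals" for L k b
        by (rule field_functional_add[OF that field_functional_scale[OF XF]])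
      show "L \<in> borel_measurable p" if "L \<in> field_functionals" for L
        by (rule measurable_field_functional[OF p(2) that])
      show "X k \<in> borel_measurable p" for k
        by (rule measurable_field_functional[OF p(2) XF])
      show "(CLINT z|p. iexp (L z)) = (CLINT z|q. iexp (L z))" if "L \<in> field_functionals" for L
        by (rule iexp_eq[OF that])
      show "A k \<in> sets borel" if "k \<in> K" for k by (rule A[OF that])
    qed (rule field_functional_zero K subset_UNIV)+
    then have "measure p ?S = measure q ?S"
      by (simp only: star[OF p(2)] star[OF q(2)] of_real_eq_iff)
    then show ?thesis by (simp only: p.emeasure_eq_measure q.emeasure_eq_measure)
  qed
  \<comment> \<open>The cylinders constrain real coordinates of the values. Both laws are therefore
    moved to a product of real lines, compared there, and recovered through \<open>recon\<close>, a
    measurable left inverse of \<open>coords\<close>.\<close>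
  define coords where "coords z = (\<lambda>k\<in>I. X k z)" for z
  define recon :: "((int ^ 'd) \<times> 'a \<Rightarrow> real) \<Rightarrow> int ^ 'd \<Rightarrow> 'a"
    where "recon w t = (\<Sum>b\<in>Basis. w (t, b) *\<^sub>R b)" for w t
  let ?P = "PiM I (\<lambda>_. borel :: real measure)"
  have bc: "recon (coords z) = z" for z
    by (rule ext) (simp add: recon_def coords_def I_def X_def inner_commute[of _ "z _"] euclidean_representation)
  have cm: "coords \<in> m \<rightarrow>\<^sub>M ?P" if "sets m = sets path_space" for m
    unfolding coords_def
    by (intro measurable_restrict measurable_field_functional[OF that XF])
  have bm: "recon \<in> ?P \<rightarrow>\<^sub>M path_space"
  proof (rule measurable_into_path_space)
    show "(\<lambda>w. recon w t) \<in> ?P \<rightarrow>\<^sub>M borel" for t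
      unfolding recon_def
    proof (intro borel_measurable_sum borel_measurable_scaleR borel_measurable_const)
      show "(\<lambda>w. w (t, b)) \<in> ?P \<rightarrow>\<^sub>M borel" if "b \<in> Basis" for b
        by (rule measurable_component_singleton) (use that in \<open>simp add: I_def\<close>)
    qed
  qed
  have inv: "distr (distr m ?P coords) path_space recon = m" if m: "sets m = sets path_space" for m
  proof -
    have "distr (distr m ?P coords) path_space recon = distr m path_space (recon \<circ> coords)"
      by (rule distr_distr[OF bm cm[OF m]])
    also have "recon \<circ> coords = (\<lambda>z. z)" by (rule ext) (simp add: bc)
    also have "distr m path_space (\<lambda>z. z) = m" by (rule distr_id2[OF m[symmetric]])
    finally show ?thesis .
  qed
  have "distr p ?P coords = distr q ?P coords"
  proof (rule measure_eqI_PiM_infinite)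
    fix A J assume J: "finite J" "J \<subseteq> I" and A: "\<And>i. i \<in> J \<Longrightarrow> A i \<in> sets (borel :: real measure)"
    have star: "emeasure (distr m ?P coords) (prod_emb I (\<lambda>_. borel) J (Pi\<^sub>E J A)) = emeasure m {z. \<forall>k\<in>J. X k z \<in> A k}"
      if m: "sets m = sets path_space" for m
    proof -
      have "coords z \<in> extensional I" for z by (simp add: coords_def)
      moreover have "coords z k = X k z" if "k \<in> J" for z k
        using J(2) that by (auto simp: coords_def)
      moreover have "space m = UNIV" using sets_eq_imp_space_eq[OF m] by simp
      ultimately have "coords -` prod_emb I (\<lambda>_. borel) J (Pi\<^sub>E J A) \<inter> space m = {z. \<forall>k\<in>J. X k z \<in> A k}"
        by (simp add: prod_emb_iff PiE_iff vimage_def)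
      moreover have "prod_emb I (\<lambda>_. borel) J (Pi\<^sub>E J A) \<in> sets ?P"
        using A by (intro sets_PiM_I J) auto
      ultimately show ?thesis by (simp only: emeasure_distr[OF cm[OF m]])
    qed
    show "emeasure (distr p ?P coords) (prod_emb I (\<lambda>_. borel) J (Pi\<^sub>E J A))
        = emeasure (distr q ?P coords) (prod_emb I (\<lambda>_. borel) J (Pi\<^sub>E J A))"
      by (simp only: star[OF p(2)] star[OF q(2)]) (rule cyl[OF J(1) A])
  next
    show "finite_measure (distr p ?P coords)"
      using p.prob_space_distr[OF cm[OF p(2)]] by (rule prob_space.finite_measure)
  qed (simp_all only: sets_distr)
  then have "distr (distr p ?P coords) path_space recon = distr (distr q ?P coords) path_space recon"
    by (simp only:)
  then show ?thesis by (simp only: inv[OF p(2)] inv[OF q(2)])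
qed

section \<open>Gaussian laws and their moments, with point masses as the case of zero
  deviation\<close>

lemma gaussian_measure_moments:
  assumes "gaussian_measure \<mu>"
  obtains m s where "0 \<le> s" "(LINT x|\<mu>. x) = m" "(LINT x|\<mu>. x\<^sup>2) = m\<^sup>2 + s\<^sup>2"
    "integrable \<mu> (\<lambda>x. x)" "integrable \<mu> (\<lambda>x. x\<^sup>2)"
    "\<mu> = (if s = 0 then return borel m else density lborel (\<lambda>x. ennreal (normal_density m s x)))"
proof -
  consider a where "\<mu> = return borel a"
    | a s where "0 < s" "\<mu> = density lborel (\<lambda>x. ennreal (normal_density a s x))"
    using assms unfolding gaussian_measure_def by blast
  then show thesis
  proof cases
    case 1
    interpret prob_space "return borel a" by (rule prob_space_return) simp
    have i: "integrable (return borel a) f" if [measurable]: "f \<in> borel_measurable borel" for f :: "real \<Rightarrow> real"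
      by (rule integrable_const_bound[where B="\<bar>f a\<bar>"]) (auto simp: AE_return)
    show ?thesis
      by (rule that[of 0 a]) (auto simp: 1 integral_return intro!: i)
  next
    case (2 a s)
    have D: "(LINT x|\<mu>. f x) = (LINT x|lborel. normal_density a s x * f x)"
      "integrable \<mu> f \<longleftrightarrow> integrable lborel (\<lambda>x. normal_density a s x * f x)"
      if "f \<in> borel_measurable borel" for f :: "real \<Rightarrow> real"
      using that unfolding 2 by (auto simp: integral_density integrable_density)
    have m1: "has_bochner_integral lborel (\<lambda>x. normal_density a s x * x) a"
      using 2(1) by (rule normal_moment_nz_1)
    have "has_bochner_integral lborel (\<lambda>x. normal_density a s x * (x - a) ^ (2 * 1)) (s\<^sup>2)"
      using normal_moment_even[OF 2(1), of a 1] 2(1) by (simp add: field_simps)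
    moreover have "has_bochner_integral lborel (normal_density a s) 1"
      using has_bochner_integral_integrable[OF integrable_normal_density[OF 2(1)]] integral_normal_density[OF 2(1)] by metis
    \<comment> \<open>The identity
      \<open>x\<^sup>2 = (x - a)\<^sup>2 + 2 * a * x - a\<^sup>2\<close> turns the central second
      moment into the raw one.\<close>
    ultimately have "has_bochner_integral lborel (\<lambda>x. normal_density a s x * (x - a) ^ (2 * 1)
        + 2 * a * (normal_density a s x * x) - a\<^sup>2 * normal_density a s x) (s\<^sup>2 + 2 * a * a - a\<^sup>2 * 1)"
      using m1 by (intro has_bochner_integral_add has_bochner_integral_diff has_bochner_integral_mult_right)
    then have m2: "has_bochner_integral lborel (\<lambda>x. normal_density a s x * x\<^sup>2) (a\<^sup>2 + s\<^sup>2)"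
      by (simp add: power2_eq_square algebra_simps)
    show ?thesis
    proof (rule that[of s a])
      show "(LINT x|\<mu>. x) = a" "integrable \<mu> (\<lambda>x. x)"
        using D[of "\<lambda>x. x"] m1 by (simp_all add: has_bochner_integral_iff)
      show "(LINT x|\<mu>. x\<^sup>2) = a\<^sup>2 + s\<^sup>2" "integrable \<mu> (\<lambda>x. x\<^sup>2)"
        using D[of "\<lambda>x. x\<^sup>2"] m2 by (simp_all add: has_bochner_integral_iff)
    qed (use 2 in simp_all)
  qed
qed

text \<open>The first two moments determine the mean and the nonnegative deviation, and whether the
  deviation is zero decides between point mass and density.\<close>

lemma gaussian_measure_eqI:
  assumes "gaussian_measure \<mu>" "gaussian_measure \<nu>"
    and "(LINT x|\<mu>. x) = (LINT x|\<nu>. x)" "(LINT x|\<mu>. x\<^sup>2) = (LINT x|\<nu>. x\<^sup>2)"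
  shows "\<mu> = \<nu>"
proof -
  obtain m s where 1: "0 \<le> s" "(LINT x|\<mu>. x) = m" "(LINT x|\<mu>. x\<^sup>2) = m\<^sup>2 + s\<^sup>2"
    "\<mu> = (if s = 0 then return borel m else density lborel (\<lambda>x. ennreal (normal_density m s x)))"
    by (rule gaussian_measure_moments[OF assms(1)])
  obtain m' s' where 2: "0 \<le> s'" "(LINT x|\<nu>. x) = m'" "(LINT x|\<nu>. x\<^sup>2) = m'\<^sup>2 + s'\<^sup>2"
    "\<nu> = (if s' = 0 then return borel m' else density lborel (\<lambda>x. ennreal (normal_density m' s' x)))"
    by (rule gaussian_measure_moments[OF assms(2)])
  have "m = m'" using 1 2 assms by simp
  moreover have "s = s'" using 1(1,3) 2(1,3) assms(4) \<open>m = m'\<close> by simp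
  ultimately show ?thesis using 1(4) 2(4) by simp
qed

lemma gaussian_field_square_integrable:
  assumes "sets p = sets path_space" "gaussian_field p" "L \<in> field_functionals"
  shows "integrable p (\<lambda>z. (L z)\<^sup>2)"
proof -
  have "gaussian_measure (distr p borel L)" using assms by (simp add: gaussian_field_iff)
  then have "integrable (distr p borel L) (\<lambda>x. x\<^sup>2)" by (rule gaussian_measure_moments)
  then show ?thesis
    using measurable_field_functional[OF assms(1,3)] by (simp add: integrable_distr_eq)
qed

lemma integrable_mult_of_squares:
  fixes f g :: "'a \<Rightarrow> real"
  assumes [measurable]: "f \<in> borel_measurable M" "g \<in> borel_measurable M"
    and "integrable M (\<lambda>x. (f x)\<^sup>2)" "integrable M (\<lambda>x. (g x)\<^sup>2)"
  shows "integrable M (\<lambda>x. f x * g x)"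
proof (rule Bochner_Integration.integrable_bound)
  show "integrable M (\<lambda>x. (f x)\<^sup>2 + (g x)\<^sup>2)" using assms by simp
  have "\<bar>a * b\<bar> \<le> a\<^sup>2 + b\<^sup>2" for a b :: real
    using sum_squares_bound[of "\<bar>a\<bar>" "\<bar>b\<bar>"] mult_nonneg_nonneg[OF abs_ge_zero abs_ge_zero, of a b]
    by (simp only: abs_mult power2_abs mult.assoc)
  then show "AE x in M. norm (f x * g x) \<le> norm ((f x)\<^sup>2 + (g x)\<^sup>2)" by simp
qed simp

lemma gaussian_field_integrable_mult:
  assumes "sets p = sets path_space" "gaussian_field p" "L \<in> field_functionals" "M \<in> field_functionals"
  shows "integrable p (\<lambda>z. L z * M z)"
  using assms by (intro integrable_mult_of_squares measurable_field_functional gaussian_field_square_integrable)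

text \<open>A linear functional of a centred field has mean zero, and its second moment is a
  combination of covariances. Being Gaussian, its law is fixed by these two numbers, so all
  one-dimensional projections agree.\<close>

theorem gaussian_field_eqI:
  fixes p q :: "(int ^ 'd \<Rightarrow> 'a::euclidean_space) measure"
  assumes p: "prob_space p" "sets p = sets path_space" "zero_mean_field p" "gaussian_field p"
    and q: "prob_space q" "sets q = sets path_space" "zero_mean_field q" "gaussian_field q"
    and eq: "\<And>u v t s. (LINT z|p. (u \<bullet> z t) * (v \<bullet> z s)) = (LINT z|q. (u \<bullet> z t) * (v \<bullet> z s))"
  shows "p = q"
proof (rule path_measure_eqI[OF p(1,2) q(1,2)])
  fix L :: "(int ^ 'd \<Rightarrow> 'a) \<Rightarrow> real" assume L: "L \<in> field_functionals"
  then obtain T a where T: "finite T" "L = (\<lambda>z. \<Sum>t\<in>T. a t \<bullet> z t)"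
    unfolding field_functionals_def by blast
  have 1: "(LINT x|distr m borel L. x) = 0"
    if "sets m = sets path_space" "zero_mean_field m" for m
  proof -
    have "(LINT x|distr m borel L. x) = (LINT z|m. L z)"
      by (rule integral_distr) (auto intro: measurable_field_functional[OF that(1) L])
    also have "\<dots> = 0"
      using that(2) by (simp add: T zero_mean_field_def)
    finally show ?thesis .
  qed
  have 2: "(LINT x|distr m borel L. x\<^sup>2) = (\<Sum>t\<in>T. \<Sum>s\<in>T. LINT z|m. (a t \<bullet> z t) * (a s \<bullet> z s))"
    if "sets m = sets path_space" "gaussian_field m" for m
  proof -
    have "(LINT x|distr m borel L. x\<^sup>2) = (LINT z|m. (L z)\<^sup>2)"
      by (rule integral_distr) (auto intro: measurable_field_functional[OF that(1) L])
    also have "\<dots> = (LINT z|m. (\<Sum>t\<in>T. \<Sum>s\<in>T. (a t \<bullet> z t) * (a s \<bullet> z s)))"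
      by (simp add: T power2_eq_square sum_product)
    also have "\<dots> = (\<Sum>t\<in>T. \<Sum>s\<in>T. LINT z|m. (a t \<bullet> z t) * (a s \<bullet> z s))"
      using gaussian_field_integrable_mult[OF that field_functional_single field_functional_single]
      by (simp add: integral_sum)
    finally show ?thesis .
  qed
  show "distr p borel L = distr q borel L"
  proof (rule gaussian_measure_eqI)
    show "(LINT x|distr p borel L. x) = (LINT x|distr q borel L. x)"
      by (simp only: 1[OF p(2,3)] 1[OF q(2,3)])
    show "(LINT x|distr p borel L. x\<^sup>2) = (LINT x|distr q borel L. x\<^sup>2)"
      by (simp only: 2[OF p(2,4)] 2[OF q(2,4)] eq)
  qed (use p(4) q(4) L in \<open>auto simp: gaussian_field_iff\<close>)
qed

section \<open>Spectral representation of covariances\<close>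

lemma gsp_lawD:
  assumes "gsp_law N p"
  shows "prob_space p" "sets p = sets path_space" "zero_mean_field p" "gaussian_field p"
    "stationary_field p" "periodic_field N p"
  using assms by (auto simp: gsp_law_def)

lemma AE_periodic_field:
  assumes "gsp_law N p" shows "AE z in p. z (t + axis l (int (N $ l))) = z t"
  using gsp_lawD(6)[OF assms] by (simp add: periodic_field_def)

text \<open>A finite filter is linear and commutes with shifts, so all properties of the law carry
  over. The value space may change, which allows the filter to output either a transported field or
  a pair of fields.\<close>

lemma gsp_law_filter:
  fixes p :: "(int ^ 'd \<Rightarrow> 'a::euclidean_space) measure"
    and B :: "int ^ 'd \<Rightarrow> 'a \<Rightarrow> 'b::euclidean_space"
  assumes p: "gsp_law N p" and S: "finite S" and lin: "\<And>s. s \<in> S \<Longrightarrow> linear (B s)"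
  shows "(\<lambda>z t. \<Sum>s\<in>S. B s (z (t - s))) \<in> p \<rightarrow>\<^sub>M path_space"
    and "gsp_law N (distr p path_space (\<lambda>z t. \<Sum>s\<in>S. B s (z (t - s))))"
proof -
  define F where "F z t = (\<Sum>s\<in>S. B s (z (t - s)))" for z t
  note p_sets = gsp_lawD(2)[OF p]
  interpret p: prob_space p by (rule gsp_lawD(1)[OF p])
  have bl: "bounded_linear (B s)" if "s \<in> S" for s
    using lin[OF that] by (simp add: linear_conv_bounded_linear)
  have Fm: "F \<in> p \<rightarrow>\<^sub>M path_space"
  proof (rule measurable_into_path_space)
    fix t
    have "(\<lambda>z. B s (z (t - s))) \<in> p \<rightarrow>\<^sub>M borel" if "s \<in> S" for s
      by (rule measurable_compose[OF measurable_component_of_law[OF p_sets]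
            borel_measurable_continuous_onI[OF linear_continuous_on[OF bl[OF that]]]])
    then show "(\<lambda>z. F z t) \<in> p \<rightarrow>\<^sub>M borel"
      unfolding F_def by (intro borel_measurable_sum)
  qed
  then show "(\<lambda>z t. \<Sum>s\<in>S. B s (z (t - s))) \<in> p \<rightarrow>\<^sub>M path_space"
    by (simp only: F_def[abs_def])
  let ?q = "distr p path_space F"
  have "prob_space ?q" by (rule p.prob_space_distr[OF Fm])
  moreover have "zero_mean_field ?q"
    unfolding zero_mean_field_def
  proof
    fix t
    have i: "integrable p (\<lambda>z. z s)" "(LINT z|p. z s) = 0" for s
      using gsp_lawD(3)[OF p] by (auto simp: zero_mean_field_def)
    have iB: "integrable p (\<lambda>z. B s (z r))" "(LINT z|p. B s (z r)) = 0" if "s \<in> S" for s r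
      using integrable_bounded_linear[OF bl[OF that] i(1)[of r]]
        integral_bounded_linear[OF bl[OF that] i(1)[of r]] linear_0[OF lin[OF that]]
      by (simp_all add: i(2))
    have "integrable p (\<lambda>z. F z t)" "(LINT z|p. F z t) = 0"
      unfolding F_def using iB by (auto simp: integral_sum)
    then show "integrable ?q (\<lambda>z. z t) \<and> (LINT z|?q. z t) = 0"
      by (simp add: integrable_distr_eq[OF Fm] integral_distr[OF Fm])
  qed
  moreover have "gaussian_field ?q"
    unfolding gaussian_field_iff
  proof
    fix L :: "(int ^ 'd \<Rightarrow> 'b) \<Rightarrow> real" assume L: "L \<in> field_functionals"
    then obtain T a where T: "finite T" "L = (\<lambda>z. \<Sum>t\<in>T. a t \<bullet> z t)"
      unfolding field_functionals_def by blast
    \<comment> \<open>Adjoints of the filter matrices move onto the coefficients, so a functional of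
      the output is a functional of the input.\<close>
    have "(\<lambda>z. L (F z)) = (\<lambda>z. \<Sum>t\<in>T. \<Sum>s\<in>S. adjoint (B s) (a t) \<bullet> z (t - s))"
    proof -
      have "a t \<bullet> B s w = adjoint (B s) (a t) \<bullet> w" if "s \<in> S" for s t w
        using adjoint_works[OF lin[OF that]] by (metis inner_commute)
      then show ?thesis unfolding T(2) F_def inner_sum_right by (intro ext sum.cong refl)
    qed
    also have "\<dots> \<in> field_functionals"
      by (intro field_functional_sum field_functional_single)
    finally have "gaussian_measure (distr p borel (L \<circ> F))"
      using gsp_lawD(4)[OF p] by (simp add: gaussian_field_iff comp_def)
    then show "gaussian_measure (distr ?q borel L)"
      by (simp add: distr_distr[OF measurable_field_functional[OF refl L] Fm])
  qed
  moreover have "stationary_field ?q"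
    unfolding stationary_field_def
  proof
    fix s
    let ?sh = "\<lambda>(z :: int ^ 'd \<Rightarrow> 'b) t. z (t + s)"
    let ?sha = "\<lambda>(z :: int ^ 'd \<Rightarrow> 'a) t. z (t + s)"
    have sh: "?sh \<in> path_space \<rightarrow>\<^sub>M path_space"
      by (intro measurable_into_path_space measurable_path_component)
    have sh': "?sha \<in> p \<rightarrow>\<^sub>M path_space"
      by (intro measurable_into_path_space measurable_component_of_law[OF p_sets])
    have Fm': "F \<in> path_space \<rightarrow>\<^sub>M path_space"
      using Fm by (simp add: measurable_cong_sets[OF p_sets refl])
    have "distr ?q path_space ?sh = distr p path_space (?sh \<circ> F)"
      by (rule distr_distr[OF sh Fm])
    also have "?sh \<circ> F = F \<circ> ?sha"
      by (simp add: fun_eq_iff F_def algebra_simps)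
    also have "distr p path_space (F \<circ> ?sha) = distr (distr p path_space ?sha) path_space F"
      by (rule distr_distr[OF Fm' sh', symmetric])
    also have "distr p path_space ?sha = p"
      using gsp_lawD(5)[OF p] by (simp add: stationary_field_def)
    finally show "distr ?q path_space ?sh = ?q" .
  qed
  moreover have "periodic_field N ?q"
    unfolding periodic_field_def
  proof (intro allI)
    fix t :: "int ^ 'd" and l :: 'd
    let ?a = "axis l (int (N $ l)) :: int ^ 'd"
    have "(\<lambda>z. z (t + ?a) - z t) \<in> path_space \<rightarrow>\<^sub>M (borel :: 'b measure)"
      by (intro borel_measurable_diff measurable_path_component)
    from measurable_sets[OF this, of "{0}"]
    have *: "{z \<in> space path_space. z (t + ?a) = (z t :: 'b)} \<in> sets path_space"
      by (simp add: vimage_def)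
    \<comment> \<open>Only finitely many lags occur, so almost sure periodicity holds at all of them
      simultaneously.\<close>
    have "AE z in p. \<forall>s\<in>S. z (t - s + ?a) = z (t - s)"
      using S by (rule AE_finite_allI) (rule AE_periodic_field[OF p])
    then have "AE z in p. F z (t + ?a) = F z t"
    proof eventually_elim
      case (elim z)
      then have "z (t + ?a - s) = z (t - s)" if "s \<in> S" for s
        using that by (simp add: algebra_simps)
      then show ?case by (simp add: F_def)
    qed
    then show "AE z in ?q. z (t + ?a) = z t"
      by (simp only: AE_distr_iff[OF Fm *])
  qed
  ultimately have "gsp_law N ?q" by (simp add: gsp_law_def)
  then show "gsp_law N (distr p path_space (\<lambda>z t. \<Sum>s\<in>S. B s (z (t - s))))"
    by (simp only: F_def[abs_def])
qed

lemma field_functional_component: "(\<lambda>z :: int ^ 'd \<Rightarrow> real ^ 'm. z t $ i) \<in> field_functionals"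
  using field_functional_single[of "axis i 1 :: real ^ 'm" t] by (simp add: inner_axis')

lemma integrable_component_mult:
  fixes p :: "(int ^ 'd \<Rightarrow> real ^ 'm) measure"
  assumes "gsp_law N p" shows "integrable p (\<lambda>z. z t $ i * z s $ k)"
  using gsp_lawD[OF assms] by (intro gaussian_field_integrable_mult field_functional_component)

lemma expectation_shift:
  fixes p :: "(int ^ 'd \<Rightarrow> 'a::euclidean_space) measure" and f :: "(int ^ 'd \<Rightarrow> 'a) \<Rightarrow> real"
  assumes p: "gsp_law N p" and f: "f \<in> borel_measurable path_space"
  shows "(LINT z|p. f (\<lambda>t. z (t + s))) = (LINT z|p. f z)"
proof -
  have "(\<lambda>z t. z (t + s)) \<in> p \<rightarrow>\<^sub>M path_space"
    by (intro measurable_into_path_space measurable_component_of_law[OF gsp_lawD(2)[OF p]])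
  from integral_distr[OF this f] gsp_lawD(5)[OF p] show ?thesis
    by (simp add: stationary_field_def)
qed

lemma expectation_component_mult:
  fixes p :: "(int ^ 'd \<Rightarrow> real ^ 'm) measure"
  assumes p: "gsp_law N p"
  shows "(LINT z|p. z t $ i * z s $ k) = covariance p (t - s) $ i $ k"
proof -
  have "(\<lambda>z :: int ^ 'd \<Rightarrow> real ^ 'm. z (t - s) $ i * z 0 $ k) \<in> borel_measurable path_space"
    by (intro borel_measurable_times measurable_field_functional[OF refl] field_functional_component)
  from expectation_shift[OF p this, of s] show ?thesis by (simp add: covariance_def)
qed

lemma covariance_periodic:
  fixes p :: "(int ^ 'd \<Rightarrow> real ^ 'm) measure"
  assumes p: "gsp_law N p"
  shows "covariance p (t + axis l (int (N $ l))) = covariance p t"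
proof -
  have m: "(\<lambda>z. z r $ i * z s $ k) \<in> borel_measurable p" for r s i k
    using integrable_component_mult[OF p] by (rule borel_measurable_integrable)
  have "(LINT z|p. z (t + axis l (int (N $ l))) $ i * z 0 $ k) = (LINT z|p. z t $ i * z 0 $ k)" for i k
    using m m by (rule integral_cong_AE) (use AE_periodic_field[OF p, of t l] in eventually_elim, simp)
  then show ?thesis by (simp add: covariance_def)
qed

lemma spectral_density_character:
  "spectral_density N p (zeta N l) $ i $ k
     = (\<Sum>t\<in>torus_grid N. of_real (covariance p t $ i $ k) * torus_character N l (- t))"
  by (simp add: spectral_density_def multi_powi_zeta)

text \<open>The covariances are real, so conjugation acts on the characters alone, where it negates
  the frequency.\<close>

lemma spectral_density_uminus:
  "spectral_density N p (zeta N (- l)) = cnj_matrix (spectral_density N p (zeta N l))"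
  by (simp add: vec_eq_iff cnj_matrix_def spectral_density_character torus_character_uminus_left)

text \<open>Swaps adjacent sums until the frequency sum is outermost and the two component sums come
  before the site sums.\<close>

lemma sum_rearrange5:
  "(\<Sum>s\<in>S. \<Sum>a\<in>A. \<Sum>r\<in>R. \<Sum>b\<in>B. \<Sum>l\<in>G. g s a r b l)
    = (\<Sum>l\<in>G. \<Sum>a\<in>A. \<Sum>b\<in>B. \<Sum>s\<in>S. \<Sum>r\<in>R. g s a r b l)"
proof -
  have "(\<Sum>s\<in>S. \<Sum>a\<in>A. \<Sum>r\<in>R. \<Sum>b\<in>B. \<Sum>l\<in>G. g s a r b l)
    = (\<Sum>s\<in>S. \<Sum>a\<in>A. \<Sum>r\<in>R. \<Sum>l\<in>G. \<Sum>b\<in>B. g s a r b l)"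
    by (rule sum.cong[OF refl])+ (rule sum.swap)
  also have "\<dots> = (\<Sum>s\<in>S. \<Sum>a\<in>A. \<Sum>l\<in>G. \<Sum>r\<in>R. \<Sum>b\<in>B. g s a r b l)"
    by (rule sum.cong[OF refl], rule sum.cong[OF refl], rule sum.swap)
  also have "\<dots> = (\<Sum>s\<in>S. \<Sum>a\<in>A. \<Sum>l\<in>G. \<Sum>b\<in>B. \<Sum>r\<in>R. g s a r b l)"
    by (rule sum.cong[OF refl], rule sum.cong[OF refl], rule sum.cong[OF refl], rule sum.swap)
  also have "\<dots> = (\<Sum>s\<in>S. \<Sum>l\<in>G. \<Sum>a\<in>A. \<Sum>b\<in>B. \<Sum>r\<in>R. g s a r b l)"
    by (rule sum.cong[OF refl], rule sum.swap)
  also have "\<dots> = (\<Sum>l\<in>G. \<Sum>s\<in>S. \<Sum>a\<in>A. \<Sum>b\<in>B. \<Sum>r\<in>R. g s a r b l)"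
    by (rule sum.swap)
  also have "\<dots> = (\<Sum>l\<in>G. \<Sum>a\<in>A. \<Sum>s\<in>S. \<Sum>b\<in>B. \<Sum>r\<in>R. g s a r b l)"
    by (rule sum.cong[OF refl], rule sum.swap)
  also have "\<dots> = (\<Sum>l\<in>G. \<Sum>a\<in>A. \<Sum>b\<in>B. \<Sum>s\<in>S. \<Sum>r\<in>R. g s a r b l)"
    by (rule sum.cong[OF refl], rule sum.cong[OF refl], rule sum.swap)
  finally show ?thesis .
qed

context
  fixes N :: "nat ^ 'd"
  assumes N: "\<forall>i. 0 < N $ i"
begin

lemma spectral_density_reduce:
  "spectral_density N p (zeta N (torus_reduce N l)) = spectral_density N p (zeta N l)"
  by (simp add: vec_eq_iff spectral_density_character torus_character_reduce[OF N]
      torus_character_commute[of N _ "- t" for t])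

lemma covariance_inversion:
  assumes "gsp_law N p"
  shows "of_nat (grid_size N) * complex_of_real (covariance p t $ i $ k)
    = (\<Sum>l\<in>torus_grid N. spectral_density N p (zeta N l) $ i $ k * torus_character N l t)"
  unfolding spectral_density_character
  by (rule torus_fourier_inversion[OF N, symmetric]) (simp add: covariance_periodic[OF assms])

text \<open>The spectral isometry: in second-order expectations the values of the field may be
  replaced by characters, at the price of the density as a weight. The position maps
  \<open>P\<close> and \<open>Q\<close> let one identity cover Fourier coefficients, where the
  position is \<open>s\<close>, and filters, where it is \<open>t - s\<close>.\<close>

lemma spectral_representation:
  fixes p :: "(int ^ 'd \<Rightarrow> real ^ 'm) measure"
  assumes p: "gsp_law N p"
  shows "of_nat (grid_size N) * (CLINT z|p. (\<Sum>s\<in>S. \<Sum>a\<in>UNIV. \<alpha> s a * of_real (z (P s) $ a))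
            * cnj (\<Sum>r\<in>R. \<Sum>b\<in>UNIV. \<beta> r b * of_real (z (Q r) $ b)))
    = (\<Sum>l\<in>torus_grid N. \<Sum>a\<in>UNIV. \<Sum>b\<in>UNIV. (\<Sum>s\<in>S. \<alpha> s a * torus_character N l (P s))
         * spectral_density N p (zeta N l) $ a $ b * cnj (\<Sum>r\<in>R. \<beta> r b * torus_character N l (Q r)))"
    and "complex_integrable p (\<lambda>z. (\<Sum>s\<in>S. \<Sum>a\<in>UNIV. \<alpha> s a * of_real (z (P s) $ a))
            * cnj (\<Sum>r\<in>R. \<Sum>b\<in>UNIV. \<beta> r b * of_real (z (Q r) $ b)))"
proof -
  define e where "e z s a r b = \<alpha> s a * cnj (\<beta> r b) * complex_of_real (z (P s) $ a * z (Q r) $ b)"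
    for z :: "int ^ 'd \<Rightarrow> real ^ 'm" and s a r b
  have prod: "(\<Sum>s\<in>S. \<Sum>a\<in>UNIV. \<alpha> s a * complex_of_real (z (P s) $ a))
      * cnj (\<Sum>r\<in>R. \<Sum>b\<in>UNIV. \<beta> r b * complex_of_real (z (Q r) $ b))
      = (\<Sum>s\<in>S. \<Sum>a\<in>UNIV. \<Sum>r\<in>R. \<Sum>b\<in>UNIV. e z s a r b)" for z :: "int ^ 'd \<Rightarrow> real ^ 'm"
    unfolding cnj_sum sum_distrib_right by (simp add: e_def sum_distrib_left mult_ac)
  have int: "complex_integrable p (\<lambda>z. e z s a r b)" for s a r b
    unfolding e_def by (intro integrable_mult_right integrable_of_real integrable_component_mult[OF p])
  show "complex_integrable p (\<lambda>z. (\<Sum>s\<in>S. \<Sum>a\<in>UNIV. \<alpha> s a * of_real (z (P s) $ a))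
            * cnj (\<Sum>r\<in>R. \<Sum>b\<in>UNIV. \<beta> r b * of_real (z (Q r) $ b)))"
    unfolding prod by (intro Bochner_Integration.integrable_sum int)
  have "of_nat (grid_size N) * (CLINT z|p. e z s a r b) = (\<Sum>l\<in>torus_grid N.
      \<alpha> s a * torus_character N l (P s) * spectral_density N p (zeta N l) $ a $ b
         * cnj (\<beta> r b * torus_character N l (Q r)))" for s a r b
  proof -
    have "(CLINT z|p. e z s a r b) = \<alpha> s a * cnj (\<beta> r b) * complex_of_real (covariance p (P s - Q r) $ a $ b)"
      by (simp only: e_def integral_mult_right_zero integral_complex_of_real expectation_component_mult[OF p])
    then have "of_nat (grid_size N) * (CLINT z|p. e z s a r b)
        = \<alpha> s a * cnj (\<beta> r b) * (of_nat (grid_size N) * complex_of_real (covariance p (P s - Q r) $ a $ b))"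
      by (simp add: mult_ac)
    also have "\<dots> = (\<Sum>l\<in>torus_grid N. \<alpha> s a * cnj (\<beta> r b) * (spectral_density N p (zeta N l) $ a $ b
        * (torus_character N l (P s) * cnj (torus_character N l (Q r)))))"
      by (simp only: covariance_inversion[OF p] sum_distrib_left torus_character_diff)
    also have "\<dots> = (\<Sum>l\<in>torus_grid N. \<alpha> s a * torus_character N l (P s) * spectral_density N p (zeta N l) $ a $ b
         * cnj (\<beta> r b * torus_character N l (Q r)))"
      by (simp add: mult_ac)
    finally show ?thesis .
  qed
  moreover have "(CLINT z|p. \<Sum>s\<in>S. \<Sum>a\<in>UNIV. \<Sum>r\<in>R. \<Sum>b\<in>UNIV. e z s a r b)
      = (\<Sum>s\<in>S. \<Sum>a\<in>UNIV. \<Sum>r\<in>R. \<Sum>b\<in>UNIV. CLINT z|p. e z s a r b)"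
    by (simp add: int)
  ultimately have "of_nat (grid_size N) * (CLINT z|p. \<Sum>s\<in>S. \<Sum>a\<in>UNIV. \<Sum>r\<in>R. \<Sum>b\<in>UNIV. e z s a r b)
      = (\<Sum>s\<in>S. \<Sum>a\<in>UNIV. \<Sum>r\<in>R. \<Sum>b\<in>UNIV. \<Sum>l\<in>torus_grid N.
      \<alpha> s a * torus_character N l (P s) * spectral_density N p (zeta N l) $ a $ b
         * cnj (\<beta> r b * torus_character N l (Q r)))"
    by (simp only: sum_distrib_left)
  also have "\<dots> = (\<Sum>l\<in>torus_grid N. \<Sum>a\<in>UNIV. \<Sum>b\<in>UNIV. \<Sum>s\<in>S. \<Sum>r\<in>R.
      \<alpha> s a * torus_character N l (P s) * spectral_density N p (zeta N l) $ a $ b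
         * cnj (\<beta> r b * torus_character N l (Q r)))"
    by (rule sum_rearrange5)
  also have "\<dots> = (\<Sum>l\<in>torus_grid N. \<Sum>a\<in>UNIV. \<Sum>b\<in>UNIV. (\<Sum>s\<in>S. \<alpha> s a * torus_character N l (P s))
         * spectral_density N p (zeta N l) $ a $ b * cnj (\<Sum>r\<in>R. \<beta> r b * torus_character N l (Q r)))"
    unfolding cnj_sum sum_distrib_right by (simp only: sum_distrib_left)
  finally show "of_nat (grid_size N) * (CLINT z|p. (\<Sum>s\<in>S. \<Sum>a\<in>UNIV. \<alpha> s a * of_real (z (P s) $ a))
            * cnj (\<Sum>r\<in>R. \<Sum>b\<in>UNIV. \<beta> r b * of_real (z (Q r) $ b)))
    = (\<Sum>l\<in>torus_grid N. \<Sum>a\<in>UNIV. \<Sum>b\<in>UNIV. (\<Sum>s\<in>S. \<alpha> s a * torus_character N l (P s))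
         * spectral_density N p (zeta N l) $ a $ b * cnj (\<Sum>r\<in>R. \<beta> r b * torus_character N l (Q r)))"
    by (simp only: prod)
qed

end

context
  fixes N :: "nat ^ 'd"
  assumes N: "\<forall>i. 0 < N $ i"
begin

text \<open>Negation leaves the grid, but followed by reduction it is an involution of the
  grid.\<close>

lemma sum_torus_grid_uminus:
  assumes "\<And>l. F (torus_reduce N l) = F l"
  shows "(\<Sum>l\<in>torus_grid N. F (- l)) = (\<Sum>l\<in>torus_grid N. F l)"
proof (rule sum.reindex_bij_witness[where i="\<lambda>l. torus_reduce N (- l)" and j="\<lambda>l. torus_reduce N (- l)"])
  have "torus_reduce N (- torus_reduce N (- l)) = l" if "l \<in> torus_grid N" for l
  proof -
    have "l $ i mod int (N $ i) = l $ i" for i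
      using that by (simp add: torus_grid_def)
    moreover have "(- (- l $ i mod int (N $ i))) mod int (N $ i) = l $ i mod int (N $ i)" for i
      by (simp add: mod_minus_eq)
    ultimately show ?thesis by (simp add: torus_reduce_def[OF N] vec_eq_iff)
  qed
  then show "torus_reduce N (- torus_reduce N (- l)) = l" "torus_reduce N (- torus_reduce N (- l)) = l"
    if "l \<in> torus_grid N" for l using that by auto
  show "F (torus_reduce N (- l)) = F (- l)" for l by (rule assms)
qed (rule torus_reduce_in_grid[OF N])+

section \<open>Discrete Fourier transform of a field over one period\<close>

definition dft :: "(int ^ 'd \<Rightarrow> real ^ 'm) \<Rightarrow> int ^ 'd \<Rightarrow> complex ^ 'm" where
  "dft x l = (\<chi> i. \<Sum>t\<in>torus_grid N. of_real (x t $ i) * cnj (torus_character N l t))"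

text \<open>Orthogonality over frequencies collapses the double sum over sites to its diagonal, one
  component at a time.\<close>

lemma dft_parseval:
  "(\<Sum>l\<in>torus_grid N. dft x l \<bullet> dft y l) = real (grid_size N) * (\<Sum>t\<in>torus_grid N. x t \<bullet> y t)"
proof -
  let ?G = "torus_grid N"
  have "(\<Sum>l\<in>?G. cnj (dft x l $ i) * dft y l $ i)
      = of_nat (grid_size N) * (\<Sum>t\<in>?G. of_real (x t $ i * y t $ i))" for i
  proof -
    have "(\<Sum>l\<in>?G. cnj (dft x l $ i) * dft y l $ i)
        = (\<Sum>l\<in>?G. \<Sum>t\<in>?G. \<Sum>s\<in>?G. of_real (x t $ i * y s $ i) * (torus_character N t l * cnj (torus_character N s l)))"
      unfolding dft_def vec_lambda_beta cnj_sum sum_distrib_right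
      unfolding sum_distrib_left
      by (intro sum.cong refl) (simp add: torus_character_commute[of N _ l for l] mult_ac)
    also have "\<dots> = (\<Sum>t\<in>?G. \<Sum>s\<in>?G. \<Sum>l\<in>?G. of_real (x t $ i * y s $ i) * (torus_character N t l * cnj (torus_character N s l)))"
      by (subst sum.swap, rule sum.cong[OF refl], rule sum.swap)
    also have "\<dots> = (\<Sum>t\<in>?G. \<Sum>s\<in>?G. if t = s then of_nat (grid_size N) * of_real (x t $ i * y t $ i) else 0)"
      unfolding sum_distrib_left[symmetric]
      by (intro sum.cong refl) (simp add: torus_character_orthogonal[OF N])
    also have "\<dots> = of_nat (grid_size N) * (\<Sum>t\<in>?G. of_real (x t $ i * y t $ i))"
      by (simp add: sum_distrib_left)
    finally show ?thesis .
  qed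
  note parseval_component = this
  have "(\<Sum>l\<in>?G. dft x l \<bullet> dft y l) = Re (\<Sum>i\<in>UNIV. \<Sum>l\<in>?G. cnj (dft x l $ i) * dft y l $ i)"
    unfolding inner_complex_vec Re_sum[symmetric] by (subst sum.swap) (rule refl)
  also have "\<dots> = real (grid_size N) * (\<Sum>t\<in>?G. x t \<bullet> y t)"
    unfolding parseval_component
    by (simp add: inner_vec_def sum_distrib_left[symmetric] sum.swap[of _ "?G"])
  finally show ?thesis .
qed

text \<open>The Fourier coefficient at \<open>l\<close> is a linear functional whose response is
  concentrated at the frequency \<open>l\<close>. Its covariance matrix is therefore
  \<open>grid_size N\<close> times the density there, and the expected quadratic form is a trace
  against it.\<close>

lemma dft_quadratic_form:
  fixes p :: "(int ^ 'd \<Rightarrow> real ^ 'm) measure"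
  assumes p: "gsp_law N p" and l: "l \<in> torus_grid N"
  shows "integrable p (\<lambda>z. dft z l \<bullet> (A *v dft z l))"
    and "(LINT z|p. dft z l \<bullet> (A *v dft z l))
        = real (grid_size N) * Re (trace (A ** spectral_density N p (zeta N l)))"
proof -
  let ?\<Phi> = "spectral_density N p (zeta N l)"
  define \<alpha> where "\<alpha> k s a = (if a = k then cnj (torus_character N l s) else 0)" for k a :: 'm and s
  have dft_eq: "dft z l $ k = (\<Sum>s\<in>torus_grid N. \<Sum>a\<in>UNIV. \<alpha> k s a * of_real (z s $ a))" for z k
  proof -
    have "\<alpha> k s a * of_real (z s $ a) = (if a = k then of_real (z s $ k) * cnj (torus_character N l s) else 0)" for s a
      by (simp add: \<alpha>_def)
    then show ?thesis by (simp add: dft_def)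
  qed
  \<comment> \<open>The response of the coefficient functional: \<open>grid_size N\<close> at
    frequency \<open>l\<close> in the selected component, zero at every other grid
    frequency.\<close>
  have \<alpha>: "(\<Sum>s\<in>torus_grid N. \<alpha> k s a * torus_character N l' s)
      = (if l' = l then if a = k then of_nat (grid_size N) else 0 else 0)" if "l' \<in> torus_grid N" for k a l'
    using torus_character_orthogonal[OF N that l] by (auto simp: \<alpha>_def mult.commute)
  note rep = spectral_representation[OF N p, where S="torus_grid N" and R="torus_grid N"
      and P="\<lambda>s. s" and Q="\<lambda>s. s", of "\<alpha> k" "\<alpha> i" for k i, folded dft_eq]
  have int: "complex_integrable p (\<lambda>z. dft z l $ k * cnj (dft z l $ i))" for k i
    by (rule rep(2))
  have cov: "(CLINT z|p. dft z l $ k * cnj (dft z l $ i)) = of_nat (grid_size N) * ?\<Phi> $ k $ i" for k i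
  proof -
    have "of_nat (grid_size N) * (CLINT z|p. dft z l $ k * cnj (dft z l $ i))
       = (\<Sum>l'\<in>torus_grid N. if l' = l then of_nat (grid_size N) * ?\<Phi> $ k $ i * of_nat (grid_size N) else 0)"
      unfolding rep(1)
    proof (rule sum.cong[OF refl])
      fix l' assume l': "l' \<in> torus_grid N"
      show "(\<Sum>a\<in>UNIV. \<Sum>b\<in>UNIV. (\<Sum>s\<in>torus_grid N. \<alpha> k s a * torus_character N l' s)
          * spectral_density N p (zeta N l') $ a $ b * cnj (\<Sum>s\<in>torus_grid N. \<alpha> i s b * torus_character N l' s))
         = (if l' = l then of_nat (grid_size N) * ?\<Phi> $ k $ i * of_nat (grid_size N) else 0)"
        unfolding \<alpha>[OF l']
        by (simp add: if_distrib[of cnj] if_distrib[of "\<lambda>x. x * _"] if_distrib[of "\<lambda>x. _ * x"] cong: if_cong)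
    qed
    also have "\<dots> = of_nat (grid_size N) * (of_nat (grid_size N) * ?\<Phi> $ k $ i)"
      using l by simp
    finally show ?thesis using grid_size_pos[OF N] by (simp del: sum.delta)
  qed
  have form: "dft z l \<bullet> (A *v dft z l) = Re (\<Sum>i\<in>UNIV. \<Sum>k\<in>UNIV. A $ i $ k * (dft z l $ k * cnj (dft z l $ i)))" for z
    unfolding inner_complex_vec matrix_vector_mult_def vec_lambda_beta sum_distrib_left
    by (simp add: mult_ac)
  have intf: "complex_integrable p (\<lambda>z. \<Sum>i\<in>UNIV. \<Sum>k\<in>UNIV. A $ i $ k * (dft z l $ k * cnj (dft z l $ i)))"
    by (intro Bochner_Integration.integrable_sum integrable_mult_right int)
  then show "integrable p (\<lambda>z. dft z l \<bullet> (A *v dft z l))"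
    unfolding form by (rule integrable_Re)
  have "(LINT z|p. dft z l \<bullet> (A *v dft z l))
      = Re (CLINT z|p. \<Sum>i\<in>UNIV. \<Sum>k\<in>UNIV. A $ i $ k * (dft z l $ k * cnj (dft z l $ i)))"
    unfolding form by (rule integral_Re[OF intf])
  also have "(CLINT z|p. \<Sum>i\<in>UNIV. \<Sum>k\<in>UNIV. A $ i $ k * (dft z l $ k * cnj (dft z l $ i)))
      = (\<Sum>i\<in>UNIV. \<Sum>k\<in>UNIV. A $ i $ k * (of_nat (grid_size N) * ?\<Phi> $ k $ i))"
    by (simp add: int cov)
  also have "\<dots> = of_nat (grid_size N) * trace (A ** ?\<Phi>)"
    by (simp add: trace_def matrix_matrix_mult_def sum_distrib_left mult_ac)
  finally show "(LINT z|p. dft z l \<bullet> (A *v dft z l))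
        = real (grid_size N) * Re (trace (A ** ?\<Phi>))" by simp
qed

lemma trace_covariance_zero:
  fixes p :: "(int ^ 'd \<Rightarrow> real ^ 'm) measure"
  assumes "gsp_law N p"
  shows "of_nat (grid_size N) * complex_of_real (\<Sum>i\<in>UNIV. covariance p 0 $ i $ i)
     = (\<Sum>l\<in>torus_grid N. trace (spectral_density N p (zeta N l)))"
  unfolding of_real_sum sum_distrib_left covariance_inversion[OF N assms] trace_def
  by (subst sum.swap) simp

text \<open>Used at negated frequencies, which lie off the grid; the density depends on the
  frequency modulo the period only.\<close>

lemma pos_def_spectral_density:
  assumes "\<forall>l\<in>torus_grid N. pos_def (spectral_density N p (zeta N l))"
  shows "pos_def (spectral_density N p (zeta N l))"
  using assms torus_reduce_in_grid[OF N, of l] spectral_density_reduce[OF N, of p l] by metis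

end

section \<open>Optimal coupling\<close>

lemma expectation_marginal:
  fixes f :: "'a \<Rightarrow> 'b::{banach, second_countable_topology}"
  assumes "distr p M g = q" "g \<in> p \<rightarrow>\<^sub>M M" "integrable q f"
  shows "integrable p (\<lambda>z. f (g z))" "(LINT z|p. f (g z)) = (LINT z|q. f z)"
proof -
  have f: "f \<in> borel_measurable M" using assms by auto
  show "integrable p (\<lambda>z. f (g z))"
    using assms(3) unfolding assms(1)[symmetric] integrable_distr_eq[OF assms(2) f] .
  show "(LINT z|p. f (g z)) = (LINT z|q. f z)" using integral_distr[OF assms(2) f] assms(1) by simp
qed

lemma measurable_marginal:
  fixes p :: "(int ^ 'd \<Rightarrow> 'a::euclidean_space \<times> 'b::euclidean_space) measure"
  assumes "sets p = sets path_space"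
  shows "(\<lambda>z t. fst (z t)) \<in> p \<rightarrow>\<^sub>M path_space" "(\<lambda>z t. snd (z t)) \<in> p \<rightarrow>\<^sub>M path_space"
proof -
  have "(\<lambda>z. fst (z t)) \<in> p \<rightarrow>\<^sub>M (borel :: 'a measure)" "(\<lambda>z. snd (z t)) \<in> p \<rightarrow>\<^sub>M (borel :: 'b measure)" for t
    by (rule measurable_compose[OF measurable_component_of_law[OF assms]];
        intro borel_measurable_continuous_onI continuous_intros)+
  then show "(\<lambda>z t. fst (z t)) \<in> p \<rightarrow>\<^sub>M path_space" "(\<lambda>z t. snd (z t)) \<in> p \<rightarrow>\<^sub>M path_space"
    by (intro measurable_into_path_space; simp)+
qed

context
  fixes N :: "nat ^ 'd" and px py :: "(int ^ 'd \<Rightarrow> real ^ 'm) measure"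
  assumes N: "\<forall>i. 0 < N $ i" and px: "gsp_law N px" and py: "gsp_law N py"
begin

text \<open>The marginals fix the two squared norms, so the cost depends on the coupling only
  through the cross term, and minimising the cost means maximising that term. Stationarity moves the
  cross term to site 0.\<close>

lemma coupling_cost:
  assumes p: "p \<in> couplings N px py"
  shows "integrable p (\<lambda>z. fst (z t) \<bullet> snd (z t))"
    and "(LINT z|p. fst (z t) \<bullet> snd (z t)) = (LINT z|p. fst (z 0) \<bullet> snd (z 0))"
    and "(LINT z|p. (norm (fst (z t) - snd (z t)))\<^sup>2)
      = (\<Sum>i\<in>UNIV. covariance px 0 $ i $ i) + (\<Sum>i\<in>UNIV. covariance py 0 $ i $ i)
        - 2 * (LINT z|p. fst (z 0) \<bullet> snd (z 0))"
proof -
  have gp: "gsp_law N p" and dx: "distr p path_space (\<lambda>z t. fst (z t)) = px"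
    and dy: "distr p path_space (\<lambda>z t. snd (z t)) = py"
    using p by (auto simp: couplings_def)
  note mg = measurable_marginal[OF gsp_lawD(2)[OF gp]]
  have sq: "integrable p (\<lambda>z. (fst (z t) $ i)\<^sup>2)" "(LINT z|p. (fst (z t) $ i)\<^sup>2) = covariance px 0 $ i $ i"
    "integrable p (\<lambda>z. (snd (z t) $ i)\<^sup>2)" "(LINT z|p. (snd (z t) $ i)\<^sup>2) = covariance py 0 $ i $ i" for t i
    using expectation_marginal[OF dx mg(1) integrable_component_mult[OF px, of t i t i]]
      expectation_marginal[OF dy mg(2) integrable_component_mult[OF py, of t i t i]]
      expectation_component_mult[OF px, of t i t i] expectation_component_mult[OF py, of t i t i]
    by (simp_all add: power2_eq_square)
  have mf: "(\<lambda>z. fst (z t) $ i) \<in> borel_measurable p" "(\<lambda>z. snd (z t) $ i) \<in> borel_measurable p" for t i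
    using measurable_compose[OF mg(1) measurable_field_functional[OF refl field_functional_component]]
      measurable_compose[OF mg(2) measurable_field_functional[OF refl field_functional_component]] by auto
  have cross: "integrable p (\<lambda>z. fst (z t) $ i * snd (z t) $ i)" for t i
    by (intro integrable_mult_of_squares mf sq)
  then show int: "integrable p (\<lambda>z. fst (z t) \<bullet> snd (z t))" for t
    by (simp add: inner_vec_def)
  have "(\<lambda>z :: int ^ 'd \<Rightarrow> (real ^ 'm) \<times> (real ^ 'm). fst (z 0) \<bullet> snd (z 0)) \<in> borel_measurable path_space"
    by (rule measurable_compose[OF measurable_path_component])
       (intro borel_measurable_continuous_onI continuous_intros)
  from expectation_shift[OF gp this, of t]
  show shift: "(LINT z|p. fst (z t) \<bullet> snd (z t)) = (LINT z|p. fst (z 0) \<bullet> snd (z 0))" by simp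
  have "(norm (x - y))\<^sup>2 = (\<Sum>i\<in>UNIV. (x $ i)\<^sup>2) + (\<Sum>i\<in>UNIV. (y $ i)\<^sup>2) - 2 * (x \<bullet> y)" for x y :: "real ^ 'm"
  proof -
    have "(norm (x - y))\<^sup>2 = x \<bullet> x + y \<bullet> y - 2 * (x \<bullet> y)"
      by (simp add: power2_norm_eq_inner inner_diff inner_commute)
    then show ?thesis
      by (simp only: inner_vec_def[of x x] inner_vec_def[of y y] inner_real_def power2_eq_square)
  qed
  then have "(LINT z|p. (norm (fst (z t) - snd (z t)))\<^sup>2)
      = (\<Sum>i\<in>UNIV. covariance px 0 $ i $ i) + (\<Sum>i\<in>UNIV. covariance py 0 $ i $ i)
        - 2 * (LINT z|p. fst (z t) \<bullet> snd (z t))"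
    using sq int by simp
  then show "(LINT z|p. (norm (fst (z t) - snd (z t)))\<^sup>2)
      = (\<Sum>i\<in>UNIV. covariance px 0 $ i $ i) + (\<Sum>i\<in>UNIV. covariance py 0 $ i $ i)
        - 2 * (LINT z|p. fst (z 0) \<bullet> snd (z 0))"
    by (simp only: shift)
qed

context
  assumes pdx: "\<forall>l\<in>torus_grid N. pos_def (spectral_density N px (zeta N l))"
    and pdy: "\<forall>l\<in>torus_grid N. pos_def (spectral_density N py (zeta N l))"
begin

definition transfer :: "int ^ 'd \<Rightarrow> complex ^ 'm ^ 'm" where
  "transfer l = transport_matrix (spectral_density N px (zeta N l)) (spectral_density N py (zeta N l))"

definition transfer_root :: "int ^ 'd \<Rightarrow> complex ^ 'm ^ 'm" where
  "transfer_root l = psd_sqrt (psd_sqrt (spectral_density N py (zeta N l))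
     ** spectral_density N px (zeta N l) ** psd_sqrt (spectral_density N py (zeta N l)))"

lemma pos_def_densities:
  "pos_def (spectral_density N px (zeta N l))" "pos_def (spectral_density N py (zeta N l))"
  using pos_def_spectral_density[OF N pdx] pos_def_spectral_density[OF N pdy] by auto

text \<open>Each quadratic form in the pointwise inequality involves a single marginal, so its
  expectation is the same for every coupling. The matrix \<open>transfer l\<close> is chosen so that
  both expectations are \<open>grid_size N\<close> times the real part of the trace of the same
  root.\<close>

lemma coupling_bound:
  assumes p: "p \<in> couplings N px py"
  shows "real (grid_size N) * (LINT z|p. fst (z 0) \<bullet> snd (z 0)) \<le> (\<Sum>l\<in>torus_grid N. Re (trace (transfer_root l)))"
proof -
  let ?G = "torus_grid N" and ?n = "real (grid_size N)"
  have gp: "gsp_law N p" and dx: "distr p path_space (\<lambda>z t. fst (z t)) = px"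
    and dy: "distr p path_space (\<lambda>z t. snd (z t)) = py"
    using p by (auto simp: couplings_def)
  note mg = measurable_marginal[OF gsp_lawD(2)[OF gp]]
  let ?x = "\<lambda>z l. dft N (\<lambda>t. fst (z t)) l :: complex ^ 'm" and ?y = "\<lambda>z l. dft N (\<lambda>t. snd (z t)) l :: complex ^ 'm"
  have qx: "integrable p (\<lambda>z. ?x z l \<bullet> (transfer l *v ?x z l))"
    "(LINT z|p. ?x z l \<bullet> (transfer l *v ?x z l)) = ?n * Re (trace (transfer_root l))"
    and qy: "integrable p (\<lambda>z. ?y z l \<bullet> (matrix_inv (transfer l) *v ?y z l))"
    "(LINT z|p. ?y z l \<bullet> (matrix_inv (transfer l) *v ?y z l)) = ?n * Re (trace (transfer_root l))"
    if l: "l \<in> ?G" for l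
    using expectation_marginal[OF dx mg(1) dft_quadratic_form(1)[OF N px l]]
      expectation_marginal[OF dy mg(2) dft_quadratic_form(1)[OF N py l]]
      dft_quadratic_form(2)[OF N px l] dft_quadratic_form(2)[OF N py l]
      trace_transport_matrix[OF pos_def_densities(1)[of l] pos_def_densities(2)[of l]]
      trace_inv_transport_matrix[OF pos_def_densities(1)[of l] pos_def_densities(2)[of l]]
    by (simp_all add: transfer_def transfer_root_def)
  have "2 * (?n * (\<Sum>t\<in>?G. fst (z t) \<bullet> snd (z t)))
      \<le> (\<Sum>l\<in>?G. ?x z l \<bullet> (transfer l *v ?x z l) + ?y z l \<bullet> (matrix_inv (transfer l) *v ?y z l))" for z
    unfolding dft_parseval[OF N, symmetric]
    unfolding sum_distrib_left
    by (intro sum_mono inner_le_quadratic_forms)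
      (simp add: transfer_def pos_def_transport_matrix pos_def_densities)
  then have "(LINT z|p. 2 * (?n * (\<Sum>t\<in>?G. fst (z t) \<bullet> snd (z t))))
      \<le> (LINT z|p. (\<Sum>l\<in>?G. ?x z l \<bullet> (transfer l *v ?x z l) + ?y z l \<bullet> (matrix_inv (transfer l) *v ?y z l)))"
    by (intro integral_mono integrable_mult_right Bochner_Integration.integrable_sum
        Bochner_Integration.integrable_add qx qy coupling_cost(1)[OF p])
  also have "(LINT z|p. (\<Sum>l\<in>?G. ?x z l \<bullet> (transfer l *v ?x z l) + ?y z l \<bullet> (matrix_inv (transfer l) *v ?y z l)))
      = 2 * (?n * (\<Sum>l\<in>?G. Re (trace (transfer_root l))))"
    using qx qy by (simp add: sum_distrib_left)
  \<comment> \<open>By stationarity all sites contribute equally, which gives the factor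
    \<open>card ?G\<close>. The factor \<open>?n\<close> from Parseval cancels against the one in
    the expected quadratic forms.\<close>
  also have "(LINT z|p. 2 * (?n * (\<Sum>t\<in>?G. fst (z t) \<bullet> snd (z t))))
      = 2 * (?n * (real (card ?G) * (LINT z|p. fst (z 0) \<bullet> snd (z 0))))"
  proof -
    have "(\<Sum>t\<in>?G. LINT z|p. fst (z t) \<bullet> snd (z t)) = (\<Sum>t\<in>?G. LINT z|p. fst (z 0) \<bullet> snd (z 0))"
      by (intro sum.cong refl coupling_cost(2)[OF p])
    then show ?thesis using coupling_cost(1)[OF p] by simp
  qed
  finally have "real (card ?G) * (LINT z|p. fst (z 0) \<bullet> snd (z 0)) \<le> (\<Sum>l\<in>?G. Re (trace (transfer_root l)))"
    using grid_size_pos[OF N] by simp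
  moreover have "card ?G = grid_size N"
    using bij_betw_same_card[OF torus_grid_bij[of N]] by (simp add: card_PiE grid_size_def)
  ultimately show ?thesis by simp
qed

lemma transfer_reduce: "transfer (torus_reduce N l) = transfer l"
  by (simp add: transfer_def spectral_density_reduce[OF N])

lemma transfer_uminus: "transfer (- l) = cnj_matrix (transfer l)"
  by (simp add: transfer_def spectral_density_uminus transport_matrix_cnj_matrix pos_def_densities)

section \<open>The convolution kernel and the transported field\<close>

definition kernel :: "int ^ 'd \<Rightarrow> real ^ 'm ^ 'm" where
  "kernel s = (\<chi> i k. Re (\<Sum>l\<in>torus_grid N. transfer l $ i $ k * torus_character N l s) / grid_size N)"

text \<open>Taking \<open>Re\<close> in the kernel loses nothing: conjugating the sum replaces each
  frequency by its negative, and this permutes the grid modulo the period, so the sum is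
  real.\<close>

lemma kernel_complex:
  "of_nat (grid_size N) * complex_of_real (kernel s $ i $ k)
    = (\<Sum>l\<in>torus_grid N. transfer l $ i $ k * torus_character N l s)" (is "_ = ?H")
proof -
  have "cnj ?H = (\<Sum>l\<in>torus_grid N. transfer (- l) $ i $ k * torus_character N (- l) s)"
    by (simp add: transfer_uminus torus_character_uminus_left cnj_matrix_def)
  also have "\<dots> = ?H"
  proof (rule sum_torus_grid_uminus[OF N, where F="\<lambda>l. transfer l $ i $ k * torus_character N l s"])
    show "transfer (torus_reduce N l) $ i $ k * torus_character N (torus_reduce N l) s
        = transfer l $ i $ k * torus_character N l s" for l
      by (simp only: transfer_reduce torus_character_commute[of N "torus_reduce N l"]
          torus_character_commute[of N l] torus_character_reduce[OF N])
  qed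
  finally have "?H \<in> \<real>" by (simp only: Reals_cnj_iff)
  then have "complex_of_real (Re ?H) = ?H" by (rule of_real_Re)
  moreover have "real (grid_size N) * kernel s $ i $ k = Re ?H"
    using grid_size_pos[OF N] by (simp add: kernel_def)
  ultimately show ?thesis by (metis of_real_mult of_real_of_nat_eq)
qed

text \<open>Characters are eigenfunctions of convolution, and orthogonality extracts
  \<open>transfer l\<close> as the response at \<open>l\<close>.\<close>

lemma kernel_transform:
  assumes l: "l \<in> torus_grid N"
  shows "(\<Sum>s\<in>torus_grid N. complex_of_real (kernel s $ i $ k) * torus_character N l (t - s))
    = torus_character N l t * transfer l $ i $ k"
proof -
  have "of_nat (grid_size N) * (\<Sum>s\<in>torus_grid N. complex_of_real (kernel s $ i $ k) * torus_character N l (t - s))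
      = (\<Sum>s\<in>torus_grid N. (of_nat (grid_size N) * complex_of_real (kernel s $ i $ k)) * torus_character N l (t - s))"
    by (simp add: sum_distrib_left mult.assoc)
  also have "\<dots> = (\<Sum>s\<in>torus_grid N. \<Sum>l'\<in>torus_grid N. torus_character N l t * transfer l' $ i $ k
      * (torus_character N l' s * cnj (torus_character N l s)))"
    unfolding kernel_complex sum_distrib_right
    by (intro sum.cong refl) (simp add: torus_character_diff mult_ac)
  also have "\<dots> = (\<Sum>l'\<in>torus_grid N. torus_character N l t * transfer l' $ i $ k
      * (\<Sum>s\<in>torus_grid N. torus_character N l' s * cnj (torus_character N l s)))"
    by (subst sum.swap) (simp only: sum_distrib_left)
  also have "\<dots> = (\<Sum>l'\<in>torus_grid N. if l' = l then torus_character N l t * transfer l $ i $ k * of_nat (grid_size N) else 0)"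
    by (intro sum.cong refl) (simp add: torus_character_orthogonal[OF N _ l])
  also have "\<dots> = of_nat (grid_size N) * (torus_character N l t * transfer l $ i $ k)"
    using l by simp
  finally show ?thesis using grid_size_pos[OF N] by (simp only: mult_cancel_left) simp
qed

definition transported :: "(int ^ 'd \<Rightarrow> real ^ 'm) \<Rightarrow> int ^ 'd \<Rightarrow> real ^ 'm" where
  "transported z t = (\<Sum>s\<in>torus_grid N. kernel s *v z (t - s))"

lemma transported_component:
  "complex_of_real (transported z t $ i)
    = (\<Sum>s\<in>torus_grid N. \<Sum>a\<in>UNIV. complex_of_real (kernel s $ i $ a) * of_real (z (t - s) $ a))"
  by (simp add: transported_def matrix_vector_mult_def)

text \<open>Brings an unfiltered component into the shape that
  \<open>spectral_representation\<close> expects, with a single site and a unit coefficient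
  vector.\<close>

lemma component_as_sum:
  "complex_of_real (z t $ i) = (\<Sum>s\<in>{t}. \<Sum>a\<in>UNIV. (if a = i then 1 else 0) * complex_of_real (z s $ a))"
  by (simp add: if_distrib[of "\<lambda>x. x * _"] cong: if_cong)

lemma hermitian_transfer: "cnj (transfer l $ i $ k) = transfer l $ k $ i"
proof -
  have "adjoint_matrix (transfer l) = transfer l"
    using pos_def_transport_matrix[OF pos_def_densities] by (simp add: transfer_def pos_def_def)
  then show ?thesis by (simp add: adjoint_matrix_def vec_eq_iff)
qed

text \<open>Filtering turns the density \<open>P\<close> into \<open>T P\<close> times the adjoint
  of \<open>T\<close>. Since \<open>T\<close> is Hermitian, this is \<open>T P T = Q\<close>, and
  Fourier inversion returns the covariances of \<open>py\<close>.\<close>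

lemma transported_covariance:
  "(LINT z|px. transported z t $ i * transported z r $ k) = (LINT z|py. z t $ i * z r $ k)"
proof -
  let ?G = "torus_grid N"
  have "of_nat (grid_size N) * complex_of_real (LINT z|px. transported z t $ i * transported z r $ k)
      = of_nat (grid_size N) * (CLINT z|px. complex_of_real (transported z t $ i) * cnj (complex_of_real (transported z r $ k)))"
    by (simp only: integral_complex_of_real[symmetric] complex_cnj_complex_of_real of_real_mult)
  also have "\<dots> = (\<Sum>l\<in>?G. \<Sum>a\<in>UNIV. \<Sum>b\<in>UNIV. (torus_character N l t * transfer l $ i $ a)
      * spectral_density N px (zeta N l) $ a $ b * cnj (torus_character N l r * transfer l $ k $ b))"
    unfolding transported_component spectral_representation(1)[OF N px, where P="\<lambda>s. t - s" and Q="\<lambda>s. r - s"]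
    by (intro sum.cong refl) (simp only: kernel_transform)
  also have "\<dots> = (\<Sum>l\<in>?G. (transfer l ** spectral_density N px (zeta N l) ** transfer l) $ i $ k * torus_character N l (t - r))"
  proof (rule sum.cong[OF refl])
    fix l
    show "(\<Sum>a\<in>UNIV. \<Sum>b\<in>UNIV. (torus_character N l t * transfer l $ i $ a)
        * spectral_density N px (zeta N l) $ a $ b * cnj (torus_character N l r * transfer l $ k $ b))
      = (transfer l ** spectral_density N px (zeta N l) ** transfer l) $ i $ k * torus_character N l (t - r)"
      unfolding matrix_matrix_mult_def vec_lambda_beta sum_distrib_right
      by (subst sum.swap) (simp add: torus_character_diff hermitian_transfer mult_ac)
  qed
  also have "\<dots> = of_nat (grid_size N) * complex_of_real (LINT z|py. z t $ i * z r $ k)"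
    by (simp only: transfer_def transport_matrix_congruence[OF pos_def_densities]
        covariance_inversion[OF N py] expectation_component_mult[OF py])
  finally show ?thesis using grid_size_pos[OF N] by (simp only: mult_cancel_left of_real_eq_iff) simp
qed

text \<open>Only one factor is filtered, so the cross-spectral density is \<open>T P\<close>, whose
  trace at each frequency is that of the root in the bound.\<close>

lemma transported_cross_covariance:
  "of_nat (grid_size N) * complex_of_real (\<Sum>i\<in>UNIV. LINT z|px. z t $ i * transported z t $ i)
    = (\<Sum>l\<in>torus_grid N. trace (transfer_root l))"
proof -
  let ?G = "torus_grid N"
  have "of_nat (grid_size N) * complex_of_real (LINT z|px. z t $ i * transported z t $ i)
      = (\<Sum>l\<in>?G. (transfer l ** spectral_density N px (zeta N l)) $ i $ i)" for i
  proof -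
    have "of_nat (grid_size N) * complex_of_real (LINT z|px. z t $ i * transported z t $ i)
      = of_nat (grid_size N) * (CLINT z|px. complex_of_real (transported z t $ i) * cnj (complex_of_real (z t $ i)))"
      by (simp only: integral_complex_of_real[symmetric] complex_cnj_complex_of_real of_real_mult mult.commute)
    also have "\<dots> = (\<Sum>l\<in>?G. \<Sum>a\<in>UNIV. \<Sum>b\<in>UNIV. (torus_character N l t * transfer l $ i $ a)
        * spectral_density N px (zeta N l) $ a $ b * cnj (\<Sum>r\<in>{t}. (if b = i then 1 else 0) * torus_character N l r))"
      unfolding arg_cong2[where f="\<lambda>a b. a * cnj b", OF transported_component component_as_sum]
        spectral_representation(1)[OF N px, where P="\<lambda>s. t - s" and Q="\<lambda>s. s"]
      by (intro sum.cong refl) (simp only: kernel_transform)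
    also have "\<dots> = (\<Sum>l\<in>?G. (transfer l ** spectral_density N px (zeta N l)) $ i $ i)"
    proof (rule sum.cong[OF refl])
      fix l
      \<comment> \<open>Both factors sit at the same site, so the phases cancel.\<close>
      have "torus_character N l t * cnj (torus_character N l t) = 1"
        using torus_character_diff[of N l t t] by simp
      then have "(torus_character N l t * transfer l $ i $ a) * spectral_density N px (zeta N l) $ a $ b
          * cnj (\<Sum>r\<in>{t}. (if b = i then 1 else 0) * torus_character N l r)
        = (if b = i then transfer l $ i $ a * spectral_density N px (zeta N l) $ a $ i else 0)" for a b
        by (simp add: mult_ac)
      then show "(\<Sum>a\<in>UNIV. \<Sum>b\<in>UNIV. (torus_character N l t * transfer l $ i $ a)
          * spectral_density N px (zeta N l) $ a $ b * cnj (\<Sum>r\<in>{t}. (if b = i then 1 else 0) * torus_character N l r))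
        = (transfer l ** spectral_density N px (zeta N l)) $ i $ i"
        by (simp only: matrix_matrix_mult_def vec_lambda_beta sum.delta finite UNIV_I if_True)
    qed
    finally show ?thesis .
  qed
  then have "of_nat (grid_size N) * complex_of_real (\<Sum>i\<in>UNIV. LINT z|px. z t $ i * transported z t $ i)
      = (\<Sum>l\<in>?G. trace (transfer l ** spectral_density N px (zeta N l)))"
    unfolding of_real_sum sum_distrib_left trace_def by (subst sum.swap) (simp only:)
  then show ?thesis
    by (simp only: transfer_def transfer_root_def trace_transport_matrix[OF pos_def_densities])
qed

text \<open>The filtered field is again Gaussian and centred, so matching component covariances
  suffice; bilinear expansion passes from components to arbitrary directions \<open>u\<close> and
  \<open>v\<close>.\<close>

lemma transported_law:
  "transported \<in> px \<rightarrow>\<^sub>M path_space" "distr px path_space transported = py"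
proof -
  note filter = gsp_law_filter[OF px finite_torus_grid[of N], of "\<lambda>s. (*v) (kernel s)",
      OF matrix_vector_mul_linear, folded transported_def]
  show m: "transported \<in> px \<rightarrow>\<^sub>M path_space" using filter(1) by simp
  have q: "gsp_law N (distr px path_space transported)" using filter(2) by simp
  show "distr px path_space transported = py"
  proof (rule gaussian_field_eqI[OF gsp_lawD(1-4)[OF q] gsp_lawD(1-4)[OF py]])
    fix u v :: "real ^ 'm" and t s
    let ?q = "distr px path_space transported"
    have comp: "(LINT z|?q. z t $ i * z s $ k) = (LINT z|py. z t $ i * z s $ k)" for i k
    proof -
      have "(\<lambda>z :: int ^ 'd \<Rightarrow> real ^ 'm. z t $ i * z s $ k) \<in> borel_measurable path_space"
        by (intro borel_measurable_times measurable_field_functional[OF refl] field_functional_component)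
      from integral_distr[OF m this] show ?thesis by (simp add: transported_covariance)
    qed
    have expand: "(LINT z|p. (u \<bullet> z t) * (v \<bullet> z s)) = (\<Sum>i\<in>UNIV. \<Sum>k\<in>UNIV. u $ i * v $ k * (LINT z|p. z t $ i * z s $ k))"
      if p: "gsp_law N p" for p :: "(int ^ 'd \<Rightarrow> real ^ 'm) measure"
    proof -
      have "(u \<bullet> z t) * (v \<bullet> z s) = (\<Sum>i\<in>UNIV. \<Sum>k\<in>UNIV. u $ i * v $ k * (z t $ i * z s $ k))" for z :: "int ^ 'd \<Rightarrow> real ^ 'm"
        unfolding inner_vec_def inner_real_def sum_product by (simp add: mult_ac)
      then show ?thesis using integrable_component_mult[OF p] by simp
    qed
    show "(LINT z|?q. (u \<bullet> z t) * (v \<bullet> z s)) = (LINT z|py. (u \<bullet> z t) * (v \<bullet> z s))"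
      by (simp only: expand[OF q] expand[OF py] comp)
  qed
qed

definition optimal_coupling :: "(int ^ 'd \<Rightarrow> (real ^ 'm) \<times> (real ^ 'm)) measure" where
  "optimal_coupling = distr px path_space (\<lambda>z t. (z t, transported z t))"

lemma optimal_coupling:
  shows "optimal_coupling \<in> couplings N px py"
    and "of_nat (grid_size N) * complex_of_real (LINT z|optimal_coupling. fst (z 0) \<bullet> snd (z 0))
      = (\<Sum>l\<in>torus_grid N. trace (transfer_root l))"
proof -
  \<comment> \<open>The pair is itself a filter of the first field: the identity at lag zero beside
    the convolution kernel. Lag zero belongs to the grid because all periods are positive. Joint
    stationarity, Gaussianity and periodicity then follow from
    \<open>gsp_law_filter\<close>.\<close>
  define B where "B s v = (if s = 0 then v else 0, kernel s *v v)" for s v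
  have B: "(\<Sum>s\<in>torus_grid N. B s (z (t - s))) = (z t, transported z t)" for z t
  proof -
    have "(\<Sum>s\<in>torus_grid N. if s = 0 then z (t - s) else 0) = (\<Sum>s\<in>torus_grid N. if s = 0 then z t else 0)"
      by (intro sum.cong) auto
    also have "\<dots> = z t"
    proof -
      have "0 \<in> torus_grid N" using N by (simp add: torus_grid_def)
      then show ?thesis by simp
    qed
    finally show ?thesis by (simp add: B_def transported_def sum_prod)
  qed
  have lin: "linear (B s)" for s
    by (rule linearI) (simp_all add: B_def matrix_vector_right_distrib matrix_vector_mult_scaleR)
  note filter = gsp_law_filter[OF px finite_torus_grid[of N], of B, OF lin, unfolded B]
  note sx = gsp_lawD(2)[OF px]
  have ms: "(\<lambda>(z :: int ^ 'd \<Rightarrow> (real ^ 'm) \<times> (real ^ 'm)) t. fst (z t)) \<in> path_space \<rightarrow>\<^sub>M (path_space :: (int ^ 'd \<Rightarrow> real ^ 'm) measure)"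
    "(\<lambda>(z :: int ^ 'd \<Rightarrow> (real ^ 'm) \<times> (real ^ 'm)) t. snd (z t))
      \<in> path_space \<rightarrow>\<^sub>M (path_space :: (int ^ 'd \<Rightarrow> real ^ 'm) measure)"
    using measurable_marginal[of "path_space :: (int ^ 'd \<Rightarrow> (real ^ 'm) \<times> (real ^ 'm)) measure"] by auto
  have "distr optimal_coupling path_space (\<lambda>z t. fst (z t)) = px"
    unfolding optimal_coupling_def distr_distr[OF ms(1) filter(1)]
    by (simp add: comp_def distr_id2[OF sx[symmetric]])
  moreover have "distr optimal_coupling path_space (\<lambda>z t. snd (z t)) = py"
    unfolding optimal_coupling_def distr_distr[OF ms(2) filter(1)]
    using transported_law(2) by (simp add: comp_def)
  ultimately show "optimal_coupling \<in> couplings N px py"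
    using filter(2) by (simp add: couplings_def optimal_coupling_def)
  have m: "(\<lambda>z :: int ^ 'd \<Rightarrow> (real ^ 'm) \<times> (real ^ 'm). fst (z 0) \<bullet> snd (z 0)) \<in> borel_measurable path_space"
    by (rule measurable_compose[OF measurable_path_component])
       (intro borel_measurable_continuous_onI continuous_intros)
  have "(LINT z|optimal_coupling. fst (z 0) \<bullet> snd (z 0)) = (LINT z|px. z 0 \<bullet> transported z 0)"
    unfolding optimal_coupling_def integral_distr[OF filter(1) m] by simp
  also have "\<dots> = (\<Sum>i\<in>UNIV. LINT z|px. z 0 $ i * transported z 0 $ i)"
  proof -
    have "integrable px (\<lambda>z. z 0 $ i * transported z 0 $ i)" for i
    proof (rule integrable_mult_of_squares)
      have "integrable px (\<lambda>z. transported z 0 $ i * transported z 0 $ i)"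
        by (rule expectation_marginal(1)[OF transported_law(2,1) integrable_component_mult[OF py]])
      then show "integrable px (\<lambda>z. (transported z 0 $ i)\<^sup>2)" by (simp add: power2_eq_square)
      show "integrable px (\<lambda>z. (z 0 $ i)\<^sup>2)"
        using integrable_component_mult[OF px] by (simp add: power2_eq_square)
      show "(\<lambda>z. transported z 0 $ i) \<in> borel_measurable px"
        by (rule measurable_compose[OF transported_law(1) measurable_field_functional[OF refl field_functional_component]])
    qed (rule measurable_field_functional[OF sx field_functional_component])
    then show ?thesis by (simp add: inner_vec_def)
  qed
  finally show "of_nat (grid_size N) * complex_of_real (LINT z|optimal_coupling. fst (z 0) \<bullet> snd (z 0))
      = (\<Sum>l\<in>torus_grid N. trace (transfer_root l))"
    by (simp only: transported_cross_covariance)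
qed

text \<open>The bound on the cross term is attained by \<open>optimal_coupling\<close>, so the cost
  has a minimum there, and an attained minimum is the infimum.\<close>

lemma law_dist_eq_cost:
  "law_dist N t px py = sqrt (LINT z|optimal_coupling. (norm (fst (z t) - snd (z t)))\<^sup>2)"
proof -
  let ?cost = "\<lambda>p :: (int ^ 'd \<Rightarrow> (real ^ 'm) \<times> (real ^ 'm)) measure. LINT z|p. (norm (fst (z t) - snd (z t)))\<^sup>2"
  let ?opt = "LINT z|optimal_coupling. fst (z 0) \<bullet> snd (z 0)"
  have "real (grid_size N) * (LINT z|p. fst (z 0) \<bullet> snd (z 0)) \<le> real (grid_size N) * ?opt"
    if "p \<in> couplings N px py" for p
  proof -
    have "real (grid_size N) * ?opt = Re (of_nat (grid_size N) * complex_of_real ?opt)" by simp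
    also have "\<dots> = (\<Sum>l\<in>torus_grid N. Re (trace (transfer_root l)))"
      by (simp only: optimal_coupling(2) Re_sum)
    finally show ?thesis using coupling_bound[OF that] by simp
  qed
  then have le: "?cost optimal_coupling \<le> ?cost p" if "p \<in> couplings N px py" for p
    using that grid_size_pos[OF N] by (simp add: coupling_cost(3) optimal_coupling(1))
  have "(INF p\<in>couplings N px py. ?cost p) = ?cost optimal_coupling"
    by (rule cInf_eq_minimum) (use le optimal_coupling(1) in auto)
  then show ?thesis by (simp only: law_dist_def)
qed

lemma law_dist_nonneg: "0 \<le> law_dist N t px py"
  by (simp add: law_dist_eq_cost)

text \<open>After multiplication by \<open>grid_size N\<close>, covariances at lag zero and the
  cross term become sums of traces over frequencies. An equation between complex numbers also
  records that the trace expression is real.\<close>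

lemma law_dist_square:
  "complex_of_real ((law_dist N t px py)\<^sup>2) =
     1 / of_nat (grid_size N) * trace (\<Sum>l\<in>torus_grid N.
       spectral_density N px (zeta N l) + spectral_density N py (zeta N l) - 2 *\<^sub>R transfer_root l)"
proof -
  let ?opt = "LINT z|optimal_coupling. fst (z 0) \<bullet> snd (z 0)"
  have "(law_dist N t px py)\<^sup>2 = (LINT z|optimal_coupling. (norm (fst (z t) - snd (z t)))\<^sup>2)"
    by (simp add: law_dist_eq_cost)
  also have "\<dots> = (\<Sum>i\<in>UNIV. covariance px 0 $ i $ i) + (\<Sum>i\<in>UNIV. covariance py 0 $ i $ i) - 2 * ?opt"
    by (rule coupling_cost(3)[OF optimal_coupling(1)])
  finally have square: "(law_dist N t px py)\<^sup>2
      = (\<Sum>i\<in>UNIV. covariance px 0 $ i $ i) + (\<Sum>i\<in>UNIV. covariance py 0 $ i $ i) - 2 * ?opt" .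
  have "of_nat (grid_size N) * complex_of_real ((law_dist N t px py)\<^sup>2)
      = of_nat (grid_size N) * complex_of_real (\<Sum>i\<in>UNIV. covariance px 0 $ i $ i)
        + of_nat (grid_size N) * complex_of_real (\<Sum>i\<in>UNIV. covariance py 0 $ i $ i)
        - 2 * (of_nat (grid_size N) * complex_of_real ?opt)"
    by (simp only: square of_real_add of_real_diff of_real_mult) (simp add: algebra_simps)
  also have "\<dots> = (\<Sum>l\<in>torus_grid N. trace (spectral_density N px (zeta N l)))
      + (\<Sum>l\<in>torus_grid N. trace (spectral_density N py (zeta N l)))
      - 2 * (\<Sum>l\<in>torus_grid N. trace (transfer_root l))"
    by (simp only: trace_covariance_zero[OF N px] trace_covariance_zero[OF N py] optimal_coupling(2))
  also have "\<dots> = trace (\<Sum>l\<in>torus_grid N.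
       spectral_density N px (zeta N l) + spectral_density N py (zeta N l) - 2 *\<^sub>R transfer_root l)"
  proof -
    have "trace (\<Sum>l\<in>S. A l) = (\<Sum>l\<in>S. trace (A l))" for A :: "int ^ 'd \<Rightarrow> complex ^ 'm ^ 'm" and S
      by (simp add: trace_def) (rule sum.swap)
    moreover have "trace (2 *\<^sub>R A) = 2 * trace A" for A :: "complex ^ 'm ^ 'm"
      by (simp add: trace_def scaleR_conv_of_real sum_distrib_left)
    ultimately show ?thesis
      by (simp add: trace_add trace_sub sum.distrib sum_subtractf sum_distrib_left)
  qed
  finally show ?thesis using grid_size_pos[OF N] by (simp add: field_simps)
qed

end

end

theorem proposition3:
  fixes N :: "nat ^ 'd"
    and px py :: "(int ^ 'd \<Rightarrow> real ^ 'm) measure"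
    and t :: "int ^ 'd"
  defines "\<Phi>x \<equiv> spectral_density N px"
    and "\<Phi>y \<equiv> spectral_density N py"
  assumes "\<forall>i. 0 < N $ i"
    and "gsp_law N px"
    and "gsp_law N py"
    and "\<forall>l\<in>torus_grid N. pos_def (\<Phi>x (zeta N l))"
    and "\<forall>l\<in>torus_grid N. pos_def (\<Phi>y (zeta N l))"
  shows "complex_of_real ((law_dist N t px py)\<^sup>2) =
           1 / of_nat (grid_size N) *
           trace (\<Sum>l\<in>torus_grid N.
             \<Phi>x (zeta N l) + \<Phi>y (zeta N l)
             - 2 *\<^sub>R psd_sqrt (psd_sqrt (\<Phi>y (zeta N l)) ** \<Phi>x (zeta N l) ** psd_sqrt (\<Phi>y (zeta N l))))
         \<and> law_dist N t px py = hellinger_dist N \<Phi>x \<Phi>y"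
proof -
  note pd = assms(6,7)[unfolded \<Phi>x_def \<Phi>y_def]
  have sq: "complex_of_real ((law_dist N t px py)\<^sup>2) =
           1 / of_nat (grid_size N) *
           trace (\<Sum>l\<in>torus_grid N.
             \<Phi>x (zeta N l) + \<Phi>y (zeta N l)
             - 2 *\<^sub>R psd_sqrt (psd_sqrt (\<Phi>y (zeta N l)) ** \<Phi>x (zeta N l) ** psd_sqrt (\<Phi>y (zeta N l))))"
    using law_dist_square[OF assms(3-5) pd, of t]
    unfolding transfer_root_def[OF assms(3-5) pd] \<Phi>x_def \<Phi>y_def .
  \<comment> \<open>Nonnegativity lets the square root undo the square, and by \<open>sq\<close> the
    trace is real, so the \<open>Re\<close> in \<open>hellinger_dist\<close> changes
    nothing.\<close>
  have "0 \<le> law_dist N t px py"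
    by (rule law_dist_nonneg[OF assms(3-5) pd])
  then have "law_dist N t px py = sqrt (Re (complex_of_real ((law_dist N t px py)\<^sup>2)))" by simp
  then have "law_dist N t px py = hellinger_dist N \<Phi>x \<Phi>y"
    unfolding sq hellinger_dist_def .
  with sq show ?thesis by blast
qed

end
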